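(* Let $r\geq 1$ be an integer. Then for all sufficiently large $n$ (i.e. for all $n\ge n_0$ for some $n_0$ depending on $r$), $$\mathrm{ex}_3(n, B_{r+1})=\Big\lfloor\frac{(n-1)^{2}}{4}\Big\rfloor+2r.$$ Moreover, $\mathrm{Ex}_3(n, B_{r+1})=\mathscr{G}_1(B_{2})$ if $r=1$, and $\mathrm{Ex}_3(n, B_{r+1})=\big\{K_{\lfloor\frac{n-1}{2}\rfloor,\lceil\frac{n-1}{2}\rceil}^{r, r}\big\}$ if $r\geq2$ (equalities of sets of graphs up to isomorphism).
   Context: All graphs are finite, simple and undirected. The book $B_{r+1}$ is the graph consisting of $r+1$ triangles sharing a common edge (and otherwise disjoint), so it has $r+3$ vertices. A graph is $H$-free if it does not contain $H$ as a (not necessarily induced) subgraph. $\mathrm{ex}_3(n,B_{r+1})$ is the maximum number of edges in a non-bipartite $B_{r+1}$-free graph on $n$ vertices, and $\mathrm{Ex}_3(n,B_{r+1})$ is the set of all non-bipartite $B_{r+1}$-free graphs on $n$ vertices with exactly $\mathrm{ex}_3(n,B_{r+1})$ edges. $T_{m,2}$ is the complete bipartite graph on $m$ vertices with parts of sizes $\lfloor m/2\rfloor$ and $\lceil m/2\rceil$. The family $\mathscr{G}_1(B_2)$ (on $n$ vertices): write the two parts of $T_{n-3,2}$ as $S^\star$ and $T^\star$; let $S_1\subseteq S^\star$ and $T_1\subseteq T^\star$ be (possibly empty) subsets with $|S_1||T_1|\le 1$; let $C_3=w_1w_2w_3w_1$ be a triangle vertex-disjoint from $T_{n-3,2}$.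 $\mathscr{G}_1(B_2)$ is the family of all graphs obtained from the disjoint union of $T_{n-3,2}$ and $C_3$ by joining $w_3$ to all vertices in $S_1\cup T_1$, $w_1$ to all vertices in $S^\star\setminus S_1$, and $w_2$ to all vertices in $T^\star\setminus T_1$. The graph $K_{\lfloor\frac{n-1}{2}\rfloor,\lceil\frac{n-1}{2}\rceil}^{r,r}$ is obtained from the complete bipartite graph $K_{\lfloor\frac{n-1}{2}\rfloor,\lceil\frac{n-1}{2}\rceil}$ by adding a new vertex $v_0$ adjacent to exactly $r$ vertices in each of the two parts. *)

theory Defs
  imports Main
begin

(* A graph is a vertex set together with a set of two-element sets of vertices. *)
type_synonym 'a ugraph = "'a set \<times> 'a set set"

abbreviation verts :: "'a ugraph \<Rightarrow> 'a set" where
  "verts \<equiv> fst"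

abbreviation edges :: "'a ugraph \<Rightarrow> 'a set set" where
  "edges \<equiv> snd"

definition simple_graph :: "'a ugraph \<Rightarrow> bool" where
  "simple_graph G \<longleftrightarrow> finite (verts G) \<and> (\<forall>e\<in>edges G. e \<subseteq> verts G \<and> card e = 2)"

(* The image of H under f need not be an induced subgraph of G. *)
definition contains_subgraph :: "'a ugraph \<Rightarrow> 'b ugraph \<Rightarrow> bool" where
  "contains_subgraph G H \<longleftrightarrow>
     (\<exists>f. inj_on f (verts H) \<and> f ` verts H \<subseteq> verts G \<and> (\<forall>e\<in>edges H. f ` e \<in> edges G))"

definition free_of :: "'b ugraph \<Rightarrow> 'a ugraph \<Rightarrow> bool" where
  "free_of H G \<longleftrightarrow> \<not> contains_subgraph G H"

definition bipartite :: "'a ugraph \<Rightarrow> bool" where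
  "bipartite G \<longleftrightarrow>
     (\<exists>A B. A \<union> B = verts G \<and> A \<inter> B = {} \<and> (\<forall>e\<in>edges G. \<exists>a\<in>A. \<exists>b\<in>B. e = {a, b}))"

definition graph_iso :: "'a ugraph \<Rightarrow> 'b ugraph \<Rightarrow> bool" where
  "graph_iso G H \<longleftrightarrow>
     (\<exists>f. bij_betw f (verts G) (verts H) \<and> edges H = (\<lambda>e. f ` e) ` edges G)"

definition same_up_to_iso :: "'a ugraph set \<Rightarrow> 'b ugraph set \<Rightarrow> bool" where
  "same_up_to_iso \<A> \<B> \<longleftrightarrow>
     (\<forall>G\<in>\<A>. \<exists>H\<in>\<B>. graph_iso G H) \<and> (\<forall>H\<in>\<B>. \<exists>G\<in>\<A>. graph_iso G H)"

(* k triangles sharing the edge {0, 1}; their third vertices are 2, ..., k + 1. *)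
definition book :: "nat \<Rightarrow> nat ugraph" where
  "book k = ({..<k + 2},
     {{0, 1}} \<union> {{0, i} | i. i \<in> {2..<k + 2}} \<union> {{1, i} | i. i \<in> {2..<k + 2}})"

(* Vertices are taken from nat, which represents every finite graph up to isomorphism. *)
definition nonbip_free_graphs :: "nat \<Rightarrow> 'b ugraph \<Rightarrow> nat ugraph set" where
  "nonbip_free_graphs n H =
     {G. simple_graph G \<and> card (verts G) = n \<and> \<not> bipartite G \<and> free_of H G}"

(* Unspecified if there is no non-bipartite H-free graph on n vertices. *)
definition ex3 :: "nat \<Rightarrow> 'b ugraph \<Rightarrow> nat" where
  "ex3 n H = Max ((\<lambda>G. card (edges G)) ` nonbip_free_graphs n H)"

definition Ex3 :: "nat \<Rightarrow> 'b ugraph \<Rightarrow> nat ugraph set" where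
  "Ex3 n H = {G \<in> nonbip_free_graphs n H. card (edges G) = ex3 n H}"

definition cross_edges :: "'a set \<Rightarrow> 'a set \<Rightarrow> 'a set set" where
  "cross_edges S T = {{s, t} | s t. s \<in> S \<and> t \<in> T}"

(* S and T are the two parts of the balanced complete bipartite graph on m vertices;
   either one may be the larger part when m is odd. *)
definition balanced_parts :: "nat \<Rightarrow> 'a set \<Rightarrow> 'a set \<Rightarrow> bool" where
  "balanced_parts m S T \<longleftrightarrow> finite S \<and> finite T \<and> S \<inter> T = {} \<and>
     card S + card T = m \<and> {card S, card T} = {m div 2, (m + 1) div 2}"

(* Intended for n \<ge> 3 because of the truncated subtraction. *)
definition G1_B2 :: "nat \<Rightarrow> nat ugraph set" where
  "G1_B2 n = {(S \<union> T \<union> {w1, w2, w3},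
       cross_edges S T \<union> {{w1, w2}, {w2, w3}, {w3, w1}} \<union>
       cross_edges {w3} (S1 \<union> T1) \<union> cross_edges {w1} (S - S1) \<union> cross_edges {w2} (T - T1))
     | S T S1 T1 w1 w2 w3.
       balanced_parts (n - 3) S T \<and> S1 \<subseteq> S \<and> T1 \<subseteq> T \<and> card S1 * card T1 \<le> 1 \<and>
       distinct [w1, w2, w3] \<and> {w1, w2, w3} \<inter> (S \<union> T) = {}}"

(* The complete bipartite graph with parts {1..p} and {p+1..p+q}, and the new vertex 0 joined
   to the first r vertices of each part; intended for r \<le> p and r \<le> q. *)
definition K_plus :: "nat \<Rightarrow> nat \<Rightarrow> nat \<Rightarrow> nat ugraph" where
  "K_plus p q r = ({0..p + q},
     cross_edges {1..p} {p + 1..p + q} \<union> cross_edges {0} ({1..r} \<union> {p + 1..p + r}))"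

end

theory Submission
  imports Defs
begin

text \<open>
A graph contains no book with \<open>r + 1\<close> pages iff adjacent vertices have at most \<open>r\<close> common
neighbours. The proof removes a triangle from a dense non-bipartite graph \<open>G\<close> on \<open>n\<close> vertices with
this property and reads off the structure of \<open>G\<close> from what is left.

If \<open>G\<close> is triangle-free, an edge with large degree sum shows that \<open>G\<close> has at most
\<open>(n - 1)\<^sup>2 div 4 + 1\<close> edges (\<open>triangle_free_nonbipartite_edges\<close>), fewer than claimed. So let \<open>W\<close> be a
triangle. Two vertices of \<open>W\<close> have at most \<open>r - 1\<close> common neighbours outside \<open>W\<close>, so at most
\<open>n + 3 * (r - 1)\<close> edges meet \<open>W\<close> (\<open>edges_le_of_triangle\<close>). Since the Mantel bound \<open>n\<^sup>2 / 4\<close> drops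
faster than that when three vertices are deleted, induction shows that every such graph, bipartite
or not, has at most \<open>n\<^sup>2 / 4 + O(r\<^sup>2)\<close> edges, and then that a non-bipartite one is below
\<open>n\<^sup>2 / 4\<close> by a term linear in \<open>n\<close> (\<open>nonbipartite_edges_le\<close>).

Consequently, if \<open>G\<close> has at least \<open>(n - 1)\<^sup>2 div 4 + 2 * r\<close> edges and \<open>n\<close> is large, then \<open>G - W\<close> is
bipartite and misses fewer than \<open>r\<close> edges of a complete bipartite graph with parts \<open>S\<close> and \<open>T\<close>. A
vertex of \<open>W\<close> with many neighbours in one part has none in the other, which leaves a vertex \<open>w1\<close>
attached to \<open>S\<close> only, a vertex \<open>w2\<close> attached to \<open>T\<close> only, and a third vertex \<open>w3\<close>. Now just two of
the three pairs in \<open>W\<close> can have common neighbours outside \<open>W\<close>, and counting again gives the exact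
bound, with equality in every step (\<open>extremal_structure\<close>): \<open>S\<close> and \<open>T\<close> are balanced and completely
joined, \<open>w1\<close> and \<open>w3\<close> cover \<open>S\<close> with \<open>r - 1\<close> vertices covered twice, and \<open>w2\<close> and \<open>w3\<close> cover \<open>T\<close> in
the same way. The edges between \<open>w3\<close> and the two parts impose the remaining conditions, which are
those of the family for \<open>r = 1\<close> and leave a single graph for \<open>r \<ge> 2\<close>.
\<close>

section \<open>Common neighbours and books\<close>

definition nbrs :: "'a set set \<Rightarrow> 'a \<Rightarrow> 'a set" where
  "nbrs E v = {u. {v, u} \<in> E}"

text \<open>Freeness of a book in local form: only adjacent pairs are constrained, and no injection of
vertex sets has to be handled.\<close>
definition codegree_le :: "nat \<Rightarrow> 'a set set \<Rightarrow> bool" where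
  "codegree_le r E \<longleftrightarrow> (\<forall>u v. {u, v} \<in> E \<longrightarrow> card (nbrs E u \<inter> nbrs E v) \<le> r)"

lemma nbrs_iff: "u \<in> nbrs E v \<longleftrightarrow> {v, u} \<in> E"
  by (simp add: nbrs_def)

lemma nbrs_subset: "simple_graph (V, E) \<Longrightarrow> nbrs E v \<subseteq> V"
  by (auto simp: simple_graph_def nbrs_def)

lemma finite_nbrs: "simple_graph (V, E) \<Longrightarrow> finite (nbrs E v)"
  by (metis nbrs_subset finite_subset simple_graph_def fst_conv)

lemma finite_edges: "simple_graph (V, E) \<Longrightarrow> finite E"
  by (rule finite_subset[of _ "Pow V"]) (auto simp: simple_graph_def)

lemma edge_distinct: "simple_graph (V, E) \<Longrightarrow> {u, v} \<in> E \<Longrightarrow> u \<noteq> v"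
  by (auto simp: simple_graph_def)

lemma edge_in_verts: "simple_graph (V, E) \<Longrightarrow> {u, v} \<in> E \<Longrightarrow> u \<in> V \<and> v \<in> V"
  by (auto simp: simple_graph_def)

lemma edgeE:
  assumes "simple_graph (V, E)" "e \<in> E"
  obtains u v where "e = {u, v}" "u \<noteq> v" "u \<in> V" "v \<in> V"
proof -
  have "card e = 2" "e \<subseteq> V" using assms by (auto simp: simple_graph_def)
  then show ?thesis using that by (auto simp: card_2_iff)
qed

lemma simple_graph_delete:
  "simple_graph (V, E) \<Longrightarrow> simple_graph (V - W, E \<inter> Pow (V - W))"
  by (auto simp: simple_graph_def)

lemma codegree_le_mono:
  assumes "simple_graph (V, E)" "codegree_le r E" "F \<subseteq> E"
  shows "codegree_le r F"
  unfolding codegree_le_def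
proof (intro allI impI)
  fix u v assume "{u, v} \<in> F"
  then have "card (nbrs E u \<inter> nbrs E v) \<le> r" using assms by (auto simp: codegree_le_def)
  moreover have "card (nbrs F u \<inter> nbrs F v) \<le> card (nbrs E u \<inter> nbrs E v)"
    using assms finite_nbrs[OF assms(1)] by (intro card_mono) (auto simp: nbrs_def)
  ultimately show "card (nbrs F u \<inter> nbrs F v) \<le> r" by simp
qed

lemma verts_book: "verts (book (r + 1)) = {..<r + 3}"
  by (simp add: book_def eval_nat_numeral)

lemma edges_book:
  "e \<in> edges (book (r + 1)) \<longleftrightarrow> e = {0, 1} \<or> (\<exists>i\<in>{2..<r + 3}. e = {0, i} \<or> e = {1, i})"
  by (auto simp: book_def eval_nat_numeral)

text \<open>A copy of the book with \<open>r + 1\<close> pages is an edge with \<open>r + 1\<close> common neighbours: the spine is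
the edge and the outer vertices of the pages are the common neighbours, which differ from the
ends of the edge because there are no loops.\<close>
lemma free_of_book_iff:
  assumes G: "simple_graph (V, E)"
  shows "free_of (book (r + 1)) (V, E) \<longleftrightarrow> codegree_le r E"
proof
  assume fr: "free_of (book (r + 1)) (V, E)"
  show "codegree_le r E"
    unfolding codegree_le_def
  proof (intro allI impI, rule ccontr)
    fix u v assume uv: "{u, v} \<in> E" and "\<not> card (nbrs E u \<inter> nbrs E v) \<le> r"
    then have "card {2..<r + 3} \<le> card (nbrs E u \<inter> nbrs E v)" by simp
    then obtain g where g: "inj_on g {2..<r + 3}" "g ` {2..<r + 3} \<subseteq> nbrs E u \<inter> nbrs E v"
      using card_le_inj[of "{2..<r + 3}" "nbrs E u \<inter> nbrs E v"] finite_nbrs[OF G] by auto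
    define f where "f i = (if i = 0 then u else if i = 1 then v else g i)" for i :: nat
    have uv_ne: "u \<noteq> v" using edge_distinct[OF G uv] .
    have nbr: "{u, g i} \<in> E \<and> {v, g i} \<in> E \<and> g i \<noteq> u \<and> g i \<noteq> v \<and> g i \<in> V"
      if "i \<in> {2..<r + 3}" for i
    proof -
      have "{u, g i} \<in> E" "{v, g i} \<in> E" using subsetD[OF g(2) imageI[OF that]] by (auto simp: nbrs_def)
      then show ?thesis using edge_distinct[OF G] edge_in_verts[OF G] by metis
    qed
    have "inj_on f {..<r + 3}"
    proof (rule inj_onI)
      fix i j assume ij: "i \<in> {..<r + 3}" "j \<in> {..<r + 3}" and eq: "f i = f j"
      have split: "k = 0 \<or> k = 1 \<or> k \<in> {2..<r + 3}" if "k \<in> {..<r + 3}" for k :: nat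
        using that by auto
      have "i = j" if "i \<in> {2..<r + 3}" "j \<in> {2..<r + 3}"
        using inj_onD[OF g(1) _ that] eq that by (simp add: f_def)
      then show "i = j"
        using split[OF ij(1)] split[OF ij(2)] nbr[of i] nbr[of j] uv_ne eq
        by (elim disjE) (simp_all add: f_def)
    qed
    moreover have "f ` {..<r + 3} \<subseteq> V"
      using nbr edge_in_verts[OF G uv] by (auto simp: f_def)
    moreover have "f ` e \<in> E" if e: "e \<in> edges (book (r + 1))" for e
    proof -
      consider "e = {0, 1}" | i where "e = {0, i} \<or> e = {1, i}" "i \<in> {2..<r + 3}"
        using e unfolding edges_book by blast
      then show ?thesis
      proof cases
        case 1
        then show ?thesis using uv by (simp add: f_def insert_commute)
      next
        case 2
        then have "f i = g i" by (simp add: f_def)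
        then show ?thesis using 2 nbr[OF 2(2)] by (elim disjE) (simp_all add: f_def insert_commute)
      qed
    qed
    ultimately have "contains_subgraph (V, E) (book (r + 1))"
      unfolding contains_subgraph_def verts_book fst_conv snd_conv by blast
    with fr show False by (simp add: free_of_def)
  qed
next
  assume le: "codegree_le r E"
  show "free_of (book (r + 1)) (V, E)"
    unfolding free_of_def
  proof
    assume "contains_subgraph (V, E) (book (r + 1))"
    then obtain f where f: "inj_on f {..<r + 3}" "\<forall>e\<in>edges (book (r + 1)). f ` e \<in> E"
      unfolding contains_subgraph_def verts_book snd_conv by blast
    have "f ` {0, 1} \<in> E" by (rule f(2)[rule_format], unfold edges_book) simp
    then have 01: "{f 0, f 1} \<in> E" by simp
    have "f i \<in> nbrs E (f 0) \<inter> nbrs E (f 1)" if "i \<in> {2..<r + 3}" for i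
    proof -
      have "f ` {0, i} \<in> E" by (rule f(2)[rule_format], unfold edges_book) (use that in blast)
      moreover have "f ` {1, i} \<in> E" by (rule f(2)[rule_format], unfold edges_book) (use that in blast)
      ultimately show ?thesis by (simp add: nbrs_def)
    qed
    then have "f ` {2..<r + 3} \<subseteq> nbrs E (f 0) \<inter> nbrs E (f 1)" by blast
    then have "card (f ` {2..<r + 3}) \<le> card (nbrs E (f 0) \<inter> nbrs E (f 1))"
      by (intro card_mono) (auto simp: finite_nbrs[OF G])
    moreover have "card (f ` {2..<r + 3}) = r + 1"
      by (subst card_image[OF inj_on_subset[OF f(1)]]) auto
    ultimately show False using le 01 by (fastforce simp: codegree_le_def)
  qed
qed

section \<open>Bipartite graphs\<close>

lemma cross_edges_iff: "{x, y} \<in> cross_edges S T \<longleftrightarrow> x \<in> S \<and> y \<in> T \<or> y \<in> S \<and> x \<in> T"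
  by (auto simp: cross_edges_def doubleton_eq_iff)

lemma cross_edges_commute: "cross_edges S T = cross_edges T S"
  by (auto simp: cross_edges_def insert_commute)

lemma cross_edges_image: "cross_edges S T = (\<lambda>(s, t). {s, t}) ` (S \<times> T)"
  by (auto simp: cross_edges_def)

lemma finite_cross_edges: "finite S \<Longrightarrow> finite T \<Longrightarrow> finite (cross_edges S T)"
  by (simp add: cross_edges_image)

lemma card_cross_edges:
  assumes "S \<inter> T = {}"
  shows "card (cross_edges S T) = card S * card T"
proof -
  have "inj_on (\<lambda>(s, t). {s, t}) (S \<times> T)"
    using assms by (auto simp: inj_on_def doubleton_eq_iff)
  then show ?thesis by (simp add: cross_edges_image card_image card_cartesian_product)
qed

lemma bipartiteI:
  assumes "simple_graph (V, E)" "V = A \<union> B" "A \<inter> B = {}"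
    and "\<And>x y. x \<in> A \<Longrightarrow> y \<in> A \<Longrightarrow> {x, y} \<notin> E" "\<And>x y. x \<in> B \<Longrightarrow> y \<in> B \<Longrightarrow> {x, y} \<notin> E"
  shows "bipartite (V, E)"
proof -
  have "\<exists>a\<in>A. \<exists>b\<in>B. e = {a, b}" if e: "e \<in> E" for e
  proof -
    obtain x y where xy: "e = {x, y}" "x \<in> A \<union> B" "y \<in> A \<union> B"
      using edgeE[OF assms(1) e] assms(2) by metis
    then consider "x \<in> A" "y \<in> B" | "y \<in> A" "x \<in> B"
      using assms(4,5)[of x y] e by auto
    then show ?thesis by cases (use xy in \<open>auto simp: insert_commute\<close>)
  qed
  then show ?thesis using assms(2,3) unfolding bipartite_def fst_conv snd_conv by blast
qed

lemma bipartite_subset_cross_edges: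
  assumes "bipartite (V, E)"
  obtains A B where "A \<union> B = V" "A \<inter> B = {}" "E \<subseteq> cross_edges A B"
  using assms by (fastforce simp: bipartite_def cross_edges_def)

lemma four_mult_le_square: "4 * (a * b) \<le> (a + b)\<^sup>2" for a b :: nat
proof -
  have "0 \<le> (int a - int b)\<^sup>2" by simp
  then have "int (4 * (a * b)) \<le> int ((a + b)\<^sup>2)"
    by (simp add: power2_eq_square algebra_simps)
  then show ?thesis by linarith
qed

section \<open>Degree sums and triangle-free graphs\<close>

text \<open>Both sides add up \<open>f v\<close> over all incident pairs \<open>v \<in> e\<close>. With a constant \<open>f\<close> this is the handshake
lemma, and with \<open>f\<close> the degree it turns degree sums along edges into a sum of squares.\<close>
lemma sum_over_incidences:
  fixes f :: "'a \<Rightarrow> nat"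
  assumes G: "simple_graph (V, E)"
  shows "(\<Sum>e\<in>E. \<Sum>v\<in>e. f v) = (\<Sum>v\<in>V. card (nbrs E v) * f v)"
proof -
  have fin: "finite V" "finite E" using G finite_edges by (auto simp: simple_graph_def)
  have "(\<Sum>e\<in>E. \<Sum>v\<in>e. f v) = (\<Sum>e\<in>E. \<Sum>v | v \<in> V \<and> v \<in> e. f v)"
    using G by (intro sum.cong) (auto simp: simple_graph_def intro: arg_cong2[where f = sum])
  also have "\<dots> = (\<Sum>v\<in>V. \<Sum>e | e \<in> E \<and> v \<in> e. f v)"
    using sum.swap_restrict[OF fin(2,1), of "\<lambda>e v. f v" "\<lambda>e v. v \<in> e"] by simp
  also have "\<dots> = (\<Sum>v\<in>V. card (nbrs E v) * f v)"
  proof (rule sum.cong)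
    fix v assume "v \<in> V"
    have "{e \<in> E. v \<in> e} = (\<lambda>u. {v, u}) ` nbrs E v"
    proof (intro equalityI subsetI)
      fix e assume e: "e \<in> {e \<in> E. v \<in> e}"
      then have "e \<in> E" by simp
      then obtain x y where xy: "e = {x, y}" using edgeE[OF G] by metis
      define u where "u = (if v = x then y else x)"
      have "e = {v, u}" using e xy by (auto simp: u_def)
      then show "e \<in> (\<lambda>u. {v, u}) ` nbrs E v" using \<open>e \<in> E\<close> by (auto simp: nbrs_def)
    qed (auto simp: nbrs_def)
    moreover have "inj_on (\<lambda>u. {v, u}) (nbrs E v)"
      by (auto simp: inj_on_def doubleton_eq_iff)
    ultimately show "(\<Sum>e | e \<in> E \<and> v \<in> e. f v) = card (nbrs E v) * f v"
      by (simp add: card_image)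
  qed simp
  finally show ?thesis .
qed

lemma sum_square_le: "(\<Sum>x\<in>A. f x)\<^sup>2 \<le> card A * (\<Sum>x\<in>A. (f x)\<^sup>2)" for f :: "'a \<Rightarrow> nat"
proof -
  have "2 * (f x * f y) \<le> (f x)\<^sup>2 + (f y)\<^sup>2" for x y
    using four_mult_le_square[of "f x" "f y"] by (simp add: power2_eq_square algebra_simps)
  then have "(\<Sum>x\<in>A. \<Sum>y\<in>A. 2 * (f x * f y)) \<le> (\<Sum>x\<in>A. \<Sum>y\<in>A. (f x)\<^sup>2 + (f y)\<^sup>2)"
    by (intro sum_mono)
  also have "\<dots> = 2 * (card A * (\<Sum>x\<in>A. (f x)\<^sup>2))"
    by (simp add: sum.distrib flip: sum_distrib_left)
  finally show ?thesis
    by (simp add: power2_eq_square sum_product flip: sum_distrib_left)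
qed

text \<open>Summing the hypothesis over all edges bounds the sum of the squared degrees by \<open>k * card E\<close>,
while by Cauchy's inequality that sum is at least \<open>(2 * card E)\<^sup>2 / card V\<close>. The lemma is used in
its contrapositive form, to find an edge whose ends have a large degree sum.\<close>
lemma edges_le_of_degree_sums:
  assumes G: "simple_graph (V, E)"
    and k: "\<And>u v. {u, v} \<in> E \<Longrightarrow> card (nbrs E u) + card (nbrs E v) \<le> k"
  shows "4 * card E \<le> card V * k"
proof (cases "card E = 0")
  case False
  let ?d = "\<lambda>v. card (nbrs E v)"
  have "(\<Sum>v\<in>e. ?d v) \<le> k" if e: "e \<in> E" for e
  proof -
    obtain u v where "e = {u, v}" "u \<noteq> v" using edgeE[OF G e] by metis
    then show ?thesis using k[of u v] e by simp
  qed
  then have "(\<Sum>v\<in>V. (?d v)\<^sup>2) \<le> card E * k"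
    using sum_over_incidences[OF G, of ?d] sum_bounded_above[of E "\<lambda>e. \<Sum>v\<in>e. ?d v" k]
    by (simp add: power2_eq_square)
  moreover have "(\<Sum>v\<in>V. ?d v) = 2 * card E"
  proof -
    have "(\<Sum>e\<in>E. card e) = (\<Sum>e\<in>E. 2)"
      using G by (intro sum.cong) (auto simp: simple_graph_def)
    then show ?thesis using sum_over_incidences[OF G, of "\<lambda>_. 1"] by simp
  qed
  ultimately have "(2 * card E)\<^sup>2 \<le> card V * (card E * k)"
    using sum_square_le[of ?d V] by (metis (no_types, lifting) le_trans mult_le_mono2)
  then have "card E * (4 * card E) \<le> card E * (card V * k)"
    by (simp add: power2_eq_square algebra_simps)
  then show ?thesis using False by simp
qed simp

lemma four_times_div4_square: "n\<^sup>2 \<le> 4 * (n\<^sup>2 div 4) + 1" for n :: nat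
proof (cases "even n")
  case True then obtain k where "n = 2 * k" by blast
  then show ?thesis by (simp add: power2_eq_square)
next
  case False then obtain k where "n = 2 * k + 1" by (blast elim: oddE)
  then have "n\<^sup>2 = 1 + 4 * (k * k + k)" by (simp add: power2_eq_square algebra_simps)
  then show ?thesis by presburger
qed

text \<open>With more edges than claimed there is an edge \<open>u v\<close> of degree sum at least \<open>card V - 1\<close>. Without
triangles, the neighbourhoods \<open>A\<close> of \<open>u\<close> and \<open>B\<close> of \<open>v\<close> are disjoint and independent, so they
miss exactly one vertex \<open>x\<close> (if they missed none, they would be a bipartition). As the graph is
not bipartite, \<open>x\<close> has sets of neighbours \<open>X \<subseteq> A\<close> and \<open>Y \<subseteq> B\<close> that are both nonempty, and there
is no edge between \<open>X\<close> and \<open>Y\<close>. Hence \<open>x\<close> contributes \<open>card X + card Y\<close> edges at the cost of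
\<open>card X * card Y\<close> edges, a gain of at most one.\<close>
lemma triangle_free_nonbipartite_edges:
  assumes G: "simple_graph (V, E)" and nb: "\<not> bipartite (V, E)"
    and tf: "\<And>u v. {u, v} \<in> E \<Longrightarrow> nbrs E u \<inter> nbrs E v = {}"
  shows "card E \<le> (card V - 1)\<^sup>2 div 4 + 1"
proof (rule ccontr)
  assume "\<not> card E \<le> (card V - 1)\<^sup>2 div 4 + 1"
  then have "(card V - 1)\<^sup>2 + 7 \<le> 4 * card E"
    using four_times_div4_square[of "card V - 1"] by linarith
  have finV: "finite V" using G by (simp add: simple_graph_def)
  have "V \<noteq> {}"
  proof
    assume "V = {}"
    then have "E = {}" using G by (fastforce simp: simple_graph_def)
    then show False using nb \<open>V = {}\<close> by (auto simp: bipartite_def)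
  qed
  then obtain m where m: "card V = Suc m" using finV by (metis card_gt_0_iff gr0_conv_Suc)
  have "card V * (m - 1) < 4 * card E"
    using \<open>(card V - 1)\<^sup>2 + 7 \<le> 4 * card E\<close> m by (cases m) (auto simp: power2_eq_square algebra_simps)
  then obtain u v where uv: "{u, v} \<in> E" and deg: "card (nbrs E u) + card (nbrs E v) > m - 1"
    using edges_le_of_degree_sums[OF G, of "m - 1"] by (meson leI le_trans not_le)
  let ?A = "nbrs E u" and ?B = "nbrs E v"
  have indep: "{x, y} \<notin> E" if "{w, x} \<in> E" "{w, y} \<in> E" for w x y
    using tf[of w x] that by (auto simp: nbrs_def)
  have indA: "{x, y} \<notin> E" if "x \<in> ?A" "y \<in> ?A" for x y
    using that indep[of u] by (auto simp: nbrs_def)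
  have indB: "{x, y} \<notin> E" if "x \<in> ?B" "y \<in> ?B" for x y
    using that indep[of v] by (auto simp: nbrs_def)
  have disj: "?A \<inter> ?B = {}" using tf[OF uv] .
  have sub: "?A \<union> ?B \<subseteq> V" using nbrs_subset[OF G] by blast
  have ne: "?A \<union> ?B \<noteq> V"
    using bipartiteI[OF G _ disj indA indB] nb by blast
  have cardAB: "card (?A \<union> ?B) = card ?A + card ?B"
    using disj finite_nbrs[OF G] by (simp add: card_Un_disjoint)
  have "card (?A \<union> ?B) < card V" using sub ne finV by (meson psubset_card_mono psubsetI)
  then have cAB: "card ?A + card ?B = m" using deg m cardAB by linarith
  then have "card (V - (?A \<union> ?B)) = 1"
    using card_Diff_subset[of "?A \<union> ?B" V] sub m cardAB finite_subset[OF sub finV] by simp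
  then obtain x where x: "V - (?A \<union> ?B) = {x}" by (auto simp: card_1_singleton_iff)
  then have V: "V = insert x (?A \<union> ?B)" and xn: "x \<notin> ?A" "x \<notin> ?B" using sub by auto
  let ?X = "nbrs E x \<inter> ?A" and ?Y = "nbrs E x \<inter> ?B"
  have loop: "{y, y} \<notin> E" for y using edge_distinct[OF G] by blast
  have "?X \<noteq> {}"
  proof
    assume "?X = {}"
    then have "{y, z} \<notin> E" if "y \<in> insert x ?A" "z \<in> insert x ?A" for y z
      using that indA loop by (auto simp: nbrs_iff insert_commute)
    then show False using bipartiteI[OF G, of "insert x ?A" ?B] nb V indB disj xn by auto
  qed
  moreover have "?Y \<noteq> {}"
  proof
    assume "?Y = {}"
    then have "{y, z} \<notin> E" if "y \<in> insert x ?B" "z \<in> insert x ?B" for y z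
      using that indB loop by (auto simp: nbrs_iff insert_commute)
    then show False using bipartiteI[OF G, of ?A "insert x ?B"] nb V indA disj xn by auto
  qed
  ultimately have pos: "card ?X \<ge> 1" "card ?Y \<ge> 1"
    using finite_nbrs[OF G] by (auto simp: Suc_le_eq card_gt_0_iff)
  have "E \<subseteq> (cross_edges ?A ?B - cross_edges ?X ?Y) \<union> cross_edges {x} (?X \<union> ?Y)"
  proof
    fix e assume e: "e \<in> E"
    then obtain y z where yz: "e = {y, z}" "y \<in> V" "z \<in> V" using edgeE[OF G] by metis
    have "e \<notin> cross_edges ?X ?Y"
      using e indep[of x] by (auto simp: cross_edges_def nbrs_def)
    moreover have "y \<noteq> z" "y \<in> insert x (?A \<union> ?B)" "z \<in> insert x (?A \<union> ?B)"
      using yz V e loop by auto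
    then consider "y = x" "z \<in> ?A \<union> ?B" | "z = x" "y \<in> ?A \<union> ?B" | "y \<in> ?A" "z \<in> ?B" | "y \<in> ?B" "z \<in> ?A"
      using e indA[of y z] indB[of y z] unfolding yz(1) by blast
    then have "e \<in> cross_edges ?A ?B \<or> e \<in> cross_edges {x} (?X \<union> ?Y)"
    proof cases
      case 1
      then have "z \<in> ?X \<union> ?Y" using e yz(1) by (simp add: nbrs_def)
      then show ?thesis using 1 yz(1) by (simp add: cross_edges_iff)
    next
      case 2
      then have "y \<in> ?X \<union> ?Y" using e yz(1) by (simp add: nbrs_def insert_commute)
      then show ?thesis using 2 yz(1) by (simp add: cross_edges_iff)
    qed (simp_all add: yz(1) cross_edges_iff)
    ultimately show "e \<in> (cross_edges ?A ?B - cross_edges ?X ?Y) \<union> cross_edges {x} (?X \<union> ?Y)"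
      by blast
  qed
  then have "card E \<le> card ((cross_edges ?A ?B - cross_edges ?X ?Y) \<union> cross_edges {x} (?X \<union> ?Y))"
    using finite_nbrs[OF G] by (intro card_mono) (auto simp: finite_cross_edges)
  also have "\<dots> \<le> card (cross_edges ?A ?B - cross_edges ?X ?Y) + card (cross_edges {x} (?X \<union> ?Y))"
    by (rule card_Un_le)
  also have "card (cross_edges ?A ?B - cross_edges ?X ?Y) = card ?A * card ?B - card ?X * card ?Y"
  proof -
    have "cross_edges ?X ?Y \<subseteq> cross_edges ?A ?B" by (auto simp: cross_edges_def)
    moreover have "card (cross_edges ?X ?Y) = card ?X * card ?Y"
      using disj by (intro card_cross_edges) auto
    moreover have "finite (cross_edges ?X ?Y)"
      using finite_nbrs[OF G] by (intro finite_cross_edges) auto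
    ultimately show ?thesis by (simp add: card_Diff_subset card_cross_edges[OF disj])
  qed
  also have "card (cross_edges {x} (?X \<union> ?Y)) = card ?X + card ?Y"
  proof -
    have "card (?X \<union> ?Y) = card ?X + card ?Y"
      using disj finite_nbrs[OF G] by (intro card_Un_disjoint) auto
    moreover have "{x} \<inter> (?X \<union> ?Y) = {}" using xn by auto
    ultimately show ?thesis by (simp only: card_cross_edges) simp
  qed
  finally have "card E \<le> card ?A * card ?B - card ?X * card ?Y + (card ?X + card ?Y)" .
  moreover have "card ?X * card ?Y \<le> card ?A * card ?B"
    using finite_nbrs[OF G] by (intro mult_le_mono card_mono) auto
  moreover have "card ?X + card ?Y \<le> card ?X * card ?Y + 1"
  proof -
    obtain a b where "card ?X = Suc a" "card ?Y = Suc b"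
      using pos by (metis Suc_le_D One_nat_def)
    then show ?thesis by simp
  qed
  ultimately have "card E \<le> card ?A * card ?B + 1" by linarith
  moreover have "4 * (card ?A * card ?B) \<le> m\<^sup>2"
    using four_mult_le_square[of "card ?A" "card ?B"] cAB by simp
  ultimately show False using \<open>\<not> card E \<le> (card V - 1)\<^sup>2 div 4 + 1\<close> m by auto
qed

section \<open>Deleting a triangle\<close>

lemma card_Un_three_le:
  assumes "finite X" "A \<subseteq> X" "B \<subseteq> X" "C \<subseteq> X"
  shows "card A + card B + card C \<le> card X + card (A \<inter> B) + card (B \<inter> C) + card (C \<inter> A)"
proof -
  have fin: "finite A" "finite B" "finite C" using assms by (auto intro: finite_subset)
  have "card A + card B = card (A \<union> B) + card (A \<inter> B)"
    using card_Un_Int[OF fin(1,2)] .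
  moreover have "card (A \<union> B) + card C = card (A \<union> B \<union> C) + card ((A \<union> B) \<inter> C)"
    using fin by (intro card_Un_Int) auto
  moreover have "card (A \<union> B \<union> C) \<le> card X" using assms by (intro card_mono) auto
  moreover have "card ((A \<union> B) \<inter> C) \<le> card (B \<inter> C) + card (C \<inter> A)"
  proof -
    have "(A \<union> B) \<inter> C = B \<inter> C \<union> C \<inter> A" by blast
    then show ?thesis using card_Un_le[of "B \<inter> C" "C \<inter> A"] by simp
  qed
  ultimately show ?thesis by linarith
qed

text \<open>A triangle comes with an ordering of its vertices, since the three vertices play different
parts in the extremal graphs.\<close>
definition triangle :: "'a set set \<Rightarrow> 'a \<Rightarrow> 'a \<Rightarrow> 'a \<Rightarrow> bool" where
  "triangle E a b c \<longleftrightarrow> distinct [a, b, c] \<and> {a, b} \<in> E \<and> {b, c} \<in> E \<and> {c, a} \<in> E"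

lemma triangle_iff_pairwise:
  assumes "distinct [a, b, c]"
  shows "triangle E a b c \<longleftrightarrow> (\<forall>x\<in>{a, b, c}. \<forall>y\<in>{a, b, c}. x \<noteq> y \<longrightarrow> {x, y} \<in> E)"
  using assms unfolding triangle_def by (auto simp: insert_commute)

lemma triangle_rotate: "triangle E a b c \<Longrightarrow> triangle E b c a"
  by (auto simp: triangle_def)

text \<open>The third vertex of the triangle already uses up one of the \<open>r\<close> common neighbours.\<close>
lemma card_common_nbrs_outside_triangle:
  assumes G: "simple_graph (V, E)" and r: "codegree_le r E" and tr: "triangle E a b c"
  shows "card (nbrs E a \<inter> nbrs E b - {a, b, c}) + 1 \<le> r"
proof -
  have "insert c (nbrs E a \<inter> nbrs E b - {a, b, c}) \<subseteq> nbrs E a \<inter> nbrs E b"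
    using tr by (auto simp: triangle_def nbrs_def insert_commute)
  then have "card (insert c (nbrs E a \<inter> nbrs E b - {a, b, c})) \<le> card (nbrs E a \<inter> nbrs E b)"
    by (rule card_mono[rotated]) (simp add: finite_nbrs[OF G])
  also have "\<dots> \<le> r" using r tr by (auto simp: codegree_le_def triangle_def)
  finally show ?thesis by (simp add: finite_nbrs[OF G])
qed

lemma edges_split_triangle:
  fixes a b c :: 'a
  assumes G: "simple_graph (V, E)" and tr: "triangle E a b c"
  defines "W \<equiv> {a, b, c}"
  defines "star \<equiv> \<lambda>w. cross_edges {w} (nbrs E w - W)"
  shows "E = E \<inter> Pow (V - W) \<union> {{a, b}, {b, c}, {c, a}} \<union> (star a \<union> star b \<union> star c)"
proof
  show "E \<subseteq> E \<inter> Pow (V - W) \<union> {{a, b}, {b, c}, {c, a}} \<union> (star a \<union> star b \<union> star c)"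
  proof
    fix e assume e: "e \<in> E"
    then obtain x y where xy: "e = {x, y}" "x \<noteq> y" "x \<in> V" "y \<in> V" using edgeE[OF G] by metis
    have star: "{w, z} \<in> star a \<union> star b \<union> star c" if "{w, z} \<in> E" "w \<in> W" "z \<notin> W" for w z
    proof -
      have "{w, z} \<in> star w" using that by (simp add: star_def cross_edges_iff nbrs_def)
      then show ?thesis using \<open>w \<in> W\<close> by (auto simp: W_def)
    qed
    consider "x \<in> W" "y \<in> W" | "x \<in> W" "y \<notin> W" | "x \<notin> W" "y \<in> W" | "x \<notin> W" "y \<notin> W" by blast
    then show "e \<in> E \<inter> Pow (V - W) \<union> {{a, b}, {b, c}, {c, a}} \<union> (star a \<union> star b \<union> star c)"
    proof cases
      case 1
      then have "{x, y} \<in> {{a, b}, {b, c}, {c, a}}"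
        unfolding W_def using xy(2) by (elim insertE emptyE) (simp_all add: insert_commute)
      then show ?thesis unfolding xy(1) by (intro UnI1[OF UnI2])
    next
      case 2
      then have "{x, y} \<in> star a \<union> star b \<union> star c" using star[of x y] e xy(1) by simp
      then show ?thesis unfolding xy(1) by (rule UnI2)
    next
      case 3
      then have "{y, x} \<in> star a \<union> star b \<union> star c"
        using star[of y x] e xy(1) by (simp add: insert_commute)
      then show ?thesis unfolding xy(1) insert_commute[of x y] by (rule UnI2)
    next
      case 4
      then show ?thesis using e xy(1,3,4) by simp
    qed
  qed
  have "star w \<subseteq> E" for w
    by (auto simp: star_def cross_edges_def nbrs_def)
  then show "E \<inter> Pow (V - W) \<union> {{a, b}, {b, c}, {c, a}} \<union> (star a \<union> star b \<union> star c) \<subseteq> E"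
    using tr unfolding triangle_def by simp
qed

lemma edges_le_delete_triangle:
  assumes G: "simple_graph (V, E)" and tr: "triangle E a b c"
  shows "card E \<le> card (E \<inter> Pow (V - {a, b, c})) + 3
    + (card (nbrs E a - {a, b, c}) + card (nbrs E b - {a, b, c}) + card (nbrs E c - {a, b, c}))"
proof -
  let ?W = "{a, b, c}"
  let ?star = "\<lambda>w. cross_edges {w} (nbrs E w - ?W)"
  have star: "card (?star w) = card (nbrs E w - ?W)" if "w \<in> ?W" for w
    using that by (subst card_cross_edges) auto
  have "card E = card (E \<inter> Pow (V - ?W) \<union> {{a, b}, {b, c}, {c, a}} \<union> (?star a \<union> ?star b \<union> ?star c))"
    using edges_split_triangle[OF G tr] by (rule arg_cong)
  also have "\<dots> \<le> card (E \<inter> Pow (V - ?W)) + card {{a, b}, {b, c}, {c, a}}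
      + (card (?star a) + card (?star b) + card (?star c))"
    by (intro order.trans[OF card_Un_le] add_mono card_Un_le order_refl)
  also have "card {{a, b}, {b, c}, {c, a}} \<le> 3" by (simp add: card_insert_if)
  finally show ?thesis by (simp add: star)
qed

text \<open>A vertex outside the triangle sends at most one edge to it, plus one for each side of the triangle
whose two ends it sees; each of the three sides is seen in this way by at most \<open>r - 1\<close> vertices. The
number of edges that meet the triangle is therefore at most \<open>3 + (card V - 3) + 3 * (r - 1)\<close>.\<close>
lemma edges_le_of_triangle:
  assumes G: "simple_graph (V, E)" and r: "codegree_le r E" and tr: "triangle E a b c"
  shows "card E + 3 \<le> card V + 3 * r + card (E \<inter> Pow (V - {a, b, c}))"
proof -
  let ?W = "{a, b, c}"
  let ?N = "\<lambda>w. nbrs E w - ?W"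
  have finV: "finite V" using G by (simp add: simple_graph_def)
  have W: "?W \<subseteq> V" "card ?W = 3"
    using tr edge_in_verts[OF G] by (auto simp: triangle_def)
  have perm: "{b, c, a} = ?W" "{c, a, b} = ?W" by auto
  have "card (?N a) + card (?N b) + card (?N c)
      \<le> card (V - ?W) + card (?N a \<inter> ?N b) + card (?N b \<inter> ?N c) + card (?N c \<inter> ?N a)"
    using nbrs_subset[OF G] finV by (intro card_Un_three_le) auto
  moreover have "card (V - ?W) + 3 = card V"
    using W finV card_mono[OF finV W(1)] by (subst card_Diff_subset) (auto simp: finite_subset)
  moreover have N: "?N x \<inter> ?N y = nbrs E x \<inter> nbrs E y - ?W" for x y by blast
  have "card (?N a \<inter> ?N b) + 1 \<le> r"
    unfolding N by (rule card_common_nbrs_outside_triangle[OF G r tr])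
  moreover have "card (?N b \<inter> ?N c) + 1 \<le> r"
    unfolding N using card_common_nbrs_outside_triangle[OF G r triangle_rotate[OF tr]]
    unfolding perm .
  moreover have "card (?N c \<inter> ?N a) + 1 \<le> r"
    unfolding N using card_common_nbrs_outside_triangle[OF G r triangle_rotate[OF triangle_rotate[OF tr]]]
    unfolding perm .
  ultimately show ?thesis using edges_le_delete_triangle[OF G tr] by linarith
qed

lemma triangle_free_or_triangle:
  assumes "simple_graph (V, E)"
  obtains a b c where "triangle E a b c" | "\<And>u v. {u, v} \<in> E \<Longrightarrow> nbrs E u \<inter> nbrs E v = {}"
proof (cases "\<exists>u v. {u, v} \<in> E \<and> nbrs E u \<inter> nbrs E v \<noteq> {}")
  case True
  then obtain u v w where "{u, v} \<in> E" "{u, w} \<in> E" "{v, w} \<in> E" by (auto simp: nbrs_def)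
  then have "triangle E u v w"
    using edge_distinct[OF assms] by (auto simp: triangle_def insert_commute)
  then show ?thesis using that by blast
qed (use that in blast)

lemma bipartite_edges_le:
  assumes G: "simple_graph (V, E)" and bip: "bipartite (V, E)"
  shows "4 * card E \<le> (card V)\<^sup>2"
proof -
  obtain A B where AB: "A \<union> B = V" "A \<inter> B = {}" "E \<subseteq> cross_edges A B"
    using bipartite_subset_cross_edges[OF bip] .
  have fin: "finite A" "finite B" using AB(1) G by (auto simp: simple_graph_def)
  have "card E \<le> card A * card B"
    using card_mono[OF finite_cross_edges[OF fin] AB(3)] by (simp add: card_cross_edges AB(2))
  then show ?thesis
    using four_mult_le_square[of "card A" "card B"] card_Un_disjoint[OF fin AB(2)] AB(1) by simp
qed

lemma edges_le_card_square:
  assumes G: "simple_graph (V, E)"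
  shows "2 * card E \<le> (card V)\<^sup>2"
proof -
  have finV: "finite V" using G by (simp add: simple_graph_def)
  have "4 * card E \<le> card V * (2 * card V)"
  proof (rule edges_le_of_degree_sums[OF G])
    have "card (nbrs E v) \<le> card V" for v
      using card_mono[OF finV nbrs_subset[OF G]] .
    then show "card (nbrs E u) + card (nbrs E v) \<le> 2 * card V" for u v
      by (simp add: mult_2 add_mono)
  qed
  then show ?thesis by (simp add: power2_eq_square)
qed

lemma card_verts_delete_triangle:
  assumes G: "simple_graph (V, E)" and tr: "triangle E a b c"
  shows "card V = card (V - {a, b, c}) + 3"
proof -
  have finV: "finite V" using G by (simp add: simple_graph_def)
  have "{a, b, c} \<subseteq> V" "card {a, b, c} = 3"
    using tr edge_in_verts[OF G] by (auto simp: triangle_def)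
  then show ?thesis using card_mono[OF finV, of "{a, b, c}"] by (simp add: card_Diff_subset)
qed

text \<open>Induction by deleting a triangle: \<open>card V\<close> decreases by three, so the square divided by four
decreases by about \<open>3/2 * card V\<close>, whereas only about \<open>card V\<close> edges are lost. The difference
pays for the error term \<open>3 * r\<close> as soon as \<open>card V \<ge> 6 * r\<close>; for fewer vertices the trivial
bound suffices, and it is what determines the constant \<open>36 * r\<^sup>2\<close>.\<close>
lemma edges_le_quarter_square_plus_const:
  assumes "simple_graph (V, E)" "codegree_le r E" "r \<ge> 1"
  shows "4 * card E \<le> (card V)\<^sup>2 + 36 * r\<^sup>2"
  using assms(1,2)
proof (induction "card V" arbitrary: V E rule: less_induct)
  case less
  note G = less.prems(1)
  have r2: "1 \<le> r\<^sup>2" using \<open>r \<ge> 1\<close> by simp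
  consider "bipartite (V, E)" | "\<not> bipartite (V, E)" "\<And>u v. {u, v} \<in> E \<Longrightarrow> nbrs E u \<inter> nbrs E v = {}"
    | a b c where "triangle E a b c"
    using triangle_free_or_triangle[OF G] by blast
  then show ?case
  proof cases
    case 1
    then show ?thesis using bipartite_edges_le[OF G] by simp
  next
    case 2
    have "card E \<le> (card V - 1)\<^sup>2 div 4 + 1" by (rule triangle_free_nonbipartite_edges[OF G 2])
    moreover have "(card V - 1)\<^sup>2 \<le> (card V)\<^sup>2" by (intro power_mono) auto
    ultimately show ?thesis using r2 by linarith
  next
    case 3
    let ?V' = "V - {a, b, c}" and ?E' = "E \<inter> Pow (V - {a, b, c})"
    have cV: "card V = card ?V' + 3" using card_verts_delete_triangle[OF G 3] .
    show ?thesis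
    proof (cases "card V < 6 * r")
      case True
      then have "(card V)\<^sup>2 \<le> (6 * r)\<^sup>2" by (intro power_mono) auto
      then show ?thesis using edges_le_card_square[OF G] by (simp add: power_mult_distrib)
    next
      case False
      have "4 * card ?E' \<le> (card ?V')\<^sup>2 + 36 * r\<^sup>2"
        using cV by (intro less.hyps simple_graph_delete[OF G] codegree_le_mono[OF less.prems]) auto
      moreover have "card E + 3 \<le> card V + 3 * r + card ?E'"
        using edges_le_of_triangle[OF less.prems 3] .
      moreover have "(card V)\<^sup>2 = (card ?V')\<^sup>2 + 6 * card ?V' + 9"
        using cV by (simp add: power2_eq_square algebra_simps)
      ultimately show ?thesis using False cV by linarith
    qed
  qed
qed

text \<open>One more deletion of a triangle, now without giving away the gain: a non-bipartite graph falls
short of the Mantel bound by an amount linear in \<open>card V\<close>.\<close>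
lemma nonbipartite_edges_le:
  assumes G: "simple_graph (V, E)" and r: "codegree_le r E" "r \<ge> 1" and nb: "\<not> bipartite (V, E)"
  shows "4 * card E + 2 * card V \<le> (card V)\<^sup>2 + 36 * r\<^sup>2 + 12 * r"
proof -
  have r2: "1 \<le> r\<^sup>2" using \<open>r \<ge> 1\<close> by simp
  consider "\<And>u v. {u, v} \<in> E \<Longrightarrow> nbrs E u \<inter> nbrs E v = {}" | a b c where "triangle E a b c"
    using triangle_free_or_triangle[OF G] by blast
  then show ?thesis
  proof cases
    case 1
    have "card E \<le> (card V - 1)\<^sup>2 div 4 + 1" by (rule triangle_free_nonbipartite_edges[OF G nb 1])
    moreover have "(card V - 1)\<^sup>2 + 2 * card V \<le> (card V)\<^sup>2 + 1"
      by (cases "card V") (auto simp: power2_eq_square)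
    ultimately show ?thesis using r2 by linarith
  next
    case 2
    let ?V' = "V - {a, b, c}" and ?E' = "E \<inter> Pow (V - {a, b, c})"
    have cV: "card V = card ?V' + 3" using card_verts_delete_triangle[OF G 2] .
    have "4 * card ?E' \<le> (card ?V')\<^sup>2 + 36 * r\<^sup>2"
      by (intro edges_le_quarter_square_plus_const[of _ _ r] simple_graph_delete[OF G] codegree_le_mono[OF G r(1)] r) auto
    moreover have "card E + 3 \<le> card V + 3 * r + card ?E'"
      using edges_le_of_triangle[OF G r(1) 2] .
    moreover have "(card V)\<^sup>2 = (card ?V')\<^sup>2 + 6 * card ?V' + 9"
      using cV by (simp add: power2_eq_square algebra_simps)
    ultimately show ?thesis using cV by linarith
  qed
qed

section \<open>The structure of extremal graphs\<close>

text \<open>The common shape of all extremal graphs: a complete bipartite graph on \<open>S\<close> and \<open>T\<close> and a triangle,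
where \<open>w1\<close> sees only \<open>S1 \<subseteq> S\<close>, \<open>w2\<close> sees only \<open>T2 \<subseteq> T\<close>, and \<open>w3\<close> sees \<open>S3 \<subseteq> S\<close> and
\<open>T3 \<subseteq> T\<close>. The family for \<open>B_2\<close> is the case \<open>S1 = S - S3\<close>, \<open>T2 = T - T3\<close>, and the single extremal
graph for larger \<open>r\<close> is the case \<open>S1 = S\<close>, \<open>T2 = T\<close>.\<close>
definition triangle_join ::
  "'a set \<Rightarrow> 'a set \<Rightarrow> 'a \<Rightarrow> 'a \<Rightarrow> 'a \<Rightarrow> 'a set \<Rightarrow> 'a set \<Rightarrow> 'a set \<Rightarrow> 'a set \<Rightarrow> 'a set set" where
  "triangle_join S T w1 w2 w3 S1 T2 S3 T3 =
     cross_edges S T \<union> {{w1, w2}, {w2, w3}, {w3, w1}} \<union>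
     cross_edges {w3} (S3 \<union> T3) \<union> cross_edges {w1} S1 \<union> cross_edges {w2} T2"

text \<open>The pairs \<open>{s, t}\<close> with \<open>t \<in> T - nbrs F s\<close> are distinct non-edges between \<open>S\<close> and \<open>T\<close>, and there
are fewer than \<open>r\<close> of these altogether.\<close>
lemma missing_nbrs_less:
  assumes F: "F \<subseteq> cross_edges S T" and fin: "finite S" "finite T" and disj: "S \<inter> T = {}"
    and large: "card S * card T < card F + r" and s: "s \<in> S"
  shows "card (T - nbrs F s) < r"
proof -
  let ?M = "(\<lambda>t. {s, t}) ` (T - nbrs F s)"
  have "?M \<inter> F = {}" by (auto simp: nbrs_def)
  have "?M \<subseteq> cross_edges S T" using s by (auto simp: cross_edges_iff)
  have "inj_on (\<lambda>t. {s, t}) (T - nbrs F s)" by (auto simp: inj_on_def doubleton_eq_iff)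
  then have "card (T - nbrs F s) + card F = card (?M \<union> F)"
    using \<open>?M \<inter> F = {}\<close> fin finite_subset[OF F finite_cross_edges[OF fin]]
    by (simp add: card_Un_disjoint card_image)
  also have "\<dots> \<le> card (cross_edges S T)"
    using \<open>?M \<subseteq> cross_edges S T\<close> F finite_cross_edges[OF fin] by (intro card_mono) auto
  finally show ?thesis using large by (simp add: card_cross_edges disj)
qed

text \<open>If \<open>w\<close> had a neighbour \<open>s\<close> in \<open>S\<close>, then all but fewer than \<open>r\<close> of its neighbours in \<open>T\<close> would be
common neighbours of \<open>w\<close> and \<open>s\<close>; at least \<open>2 * r\<close> neighbours in \<open>T\<close> leave more than \<open>r\<close>.\<close>
lemma nbrs_one_sided:
  assumes G: "simple_graph (V, E)" and r: "codegree_le r E" and FE: "F \<subseteq> E"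
    and F: "F \<subseteq> cross_edges S T" and fin: "finite S" "finite T" and disj: "S \<inter> T = {}"
    and large: "card S * card T < card F + r"
    and many: "2 * r \<le> card (nbrs E w \<inter> T)"
  shows "nbrs E w \<inter> S = {}"
proof (rule ccontr)
  assume "nbrs E w \<inter> S \<noteq> {}"
  then obtain s where s: "s \<in> S" "{w, s} \<in> E" by (auto simp: nbrs_def)
  have "nbrs E w \<inter> T \<subseteq> (nbrs E w \<inter> nbrs E s) \<union> (T - nbrs F s)"
    using FE by (auto simp: nbrs_def)
  then have "card (nbrs E w \<inter> T) \<le> card (nbrs E w \<inter> nbrs E s \<union> (T - nbrs F s))"
    using finite_nbrs[OF G] fin by (intro card_mono) auto
  also have "\<dots> \<le> card (nbrs E w \<inter> nbrs E s) + card (T - nbrs F s)" by (rule card_Un_le)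
  also have "card (nbrs E w \<inter> nbrs E s) \<le> r" using r s by (auto simp: codegree_le_def)
  finally show False using many missing_nbrs_less[OF F fin disj large s(1)] by linarith
qed

lemma square_div4_add2: "(m + 2)\<^sup>2 div 4 = m\<^sup>2 div 4 + m + 1" for m :: nat
proof -
  have "(m + 2)\<^sup>2 = m\<^sup>2 + 4 * (m + 1)" by (simp add: power2_eq_square algebra_simps)
  then show ?thesis by simp
qed

text \<open>The heart of the proof. Deleting a triangle \<open>W\<close> leaves too many edges for a non-bipartite graph,
hence a bipartite graph on \<open>S\<close> and \<open>T\<close> that misses fewer than \<open>r\<close> edges. A vertex of \<open>W\<close> with
many neighbours in one part has none in the other, and since \<open>W\<close> sends about \<open>card S + card T\<close>
edges to the two parts, some \<open>w1 \<in> W\<close> sees many vertices of \<open>S\<close> only and some \<open>w2 \<in> W\<close> sees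
many vertices of \<open>T\<close> only. Then only \<open>w1\<close> and \<open>w3\<close> compete for \<open>S\<close>, and only \<open>w2\<close> and \<open>w3\<close> for
\<open>T\<close>. Each of these pairs has at most \<open>r - 1\<close> common neighbours outside \<open>W\<close>, which gives the exact
upper bound \<open>m\<^sup>2 div 4 + 3 + m + 2 * (r - 1)\<close> with \<open>m = card S + card T\<close>. All inequalities used
are therefore equalities, and this is the claimed structure.

The bound on \<open>card V\<close> serves two purposes: the quadratic term makes the rest bipartite, and the
linear term \<open>28 * r\<close> (contained in \<open>36 * r\<close>) keeps both parts larger than \<open>7 * r\<close>.\<close>
lemma extremal_structure:
  assumes G: "simple_graph (V, E)" and r: "codegree_le r E" "r \<ge> 1"
    and nb: "\<not> bipartite (V, E)"
    and n: "card V \<ge> 18 * r\<^sup>2 + 36 * r + 10"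
    and e: "card E \<ge> (card V - 1)\<^sup>2 div 4 + 2 * r"
  obtains S T w1 w2 w3 S1 T2 S3 T3 where
    "V = S \<union> T \<union> {w1, w2, w3}" "S \<inter> T = {}" "distinct [w1, w2, w3]" "{w1, w2, w3} \<inter> (S \<union> T) = {}"
    "E = triangle_join S T w1 w2 w3 S1 T2 S3 T3"
    "S1 \<union> S3 = S" "T2 \<union> T3 = T" "card (S1 \<inter> S3) + 1 = r" "card (T2 \<inter> T3) + 1 = r"
    "card S * card T = (card V - 3)\<^sup>2 div 4" "card E = (card V - 1)\<^sup>2 div 4 + 2 * r"
proof -
  have finV: "finite V" using G by (simp add: simple_graph_def)
  have "\<exists>a b c. triangle E a b c"
  proof (rule ccontr)
    assume "\<nexists>a b c. triangle E a b c"
    then have "\<And>u v. {u, v} \<in> E \<Longrightarrow> nbrs E u \<inter> nbrs E v = {}"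
      using triangle_free_or_triangle[OF G] by metis
    then show False using triangle_free_nonbipartite_edges[OF G nb] e r(2) by fastforce
  qed
  then obtain a b c where abc: "triangle E a b c" by blast
  define W where "W = {a, b, c}"
  define F where "F = E \<inter> Pow (V - W)"
  define m where "m = card (V - W)"
  have cV: "card V = m + 3" using card_verts_delete_triangle[OF G abc] by (simp add: m_def W_def)
  have GF: "simple_graph (V - W, F)" unfolding F_def by (rule simple_graph_delete[OF G])
  have FE: "F \<subseteq> E" by (auto simp: F_def)
  have e': "card E \<ge> m\<^sup>2 div 4 + m + 1 + 2 * r"
    using e cV square_div4_add2[of m] by simp
  note m4 = four_times_div4_square[of m]
  have cF: "card E + 3 \<le> m + 3 + 3 * r + card F"
    using edges_le_of_triangle[OF G r(1) abc] cV by (simp add: F_def W_def)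
  have F_large: "m\<^sup>2 + 3 \<le> 4 * card F + 4 * r"
    using cF e' m4 r(2) by linarith
  have "bipartite (V - W, F)"
  proof (rule ccontr)
    assume "\<not> bipartite (V - W, F)"
    then have "4 * card F + 2 * m \<le> m\<^sup>2 + 36 * r\<^sup>2 + 12 * r"
      unfolding m_def by (rule nonbipartite_edges_le[OF GF codegree_le_mono[OF G r(1) FE] r(2)])
    then show False using F_large n cV by linarith
  qed
  then obtain S T where ST: "S \<union> T = V - W" "S \<inter> T = {}" and F: "F \<subseteq> cross_edges S T"
    using bipartite_subset_cross_edges by metis
  have fin: "finite S" "finite T" using ST(1) finV by (metis finite_Diff finite_Un)+
  have cST: "card S + card T = m" using ST fin by (simp add: m_def flip: card_Un_disjoint)
  have ST_le: "card S * card T \<le> m\<^sup>2 div 4"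
    using four_mult_le_square[of "card S" "card T"] cST by simp
  have FST: "card F \<le> card S * card T"
    using card_mono[OF finite_cross_edges[OF fin] F] by (simp add: card_cross_edges ST(2))
  have large: "card S * card T < card F + r" using ST_le F_large by linarith
  have one_sided_S: "nbrs E w \<inter> S = {}" if "2 * r \<le> card (nbrs E w \<inter> T)" for w
    by (rule nbrs_one_sided[OF G r(1) FE F fin ST(2) large that])
  have one_sided_T: "nbrs E w \<inter> T = {}" if "2 * r \<le> card (nbrs E w \<inter> S)" for w
    using nbrs_one_sided[OF G r(1) FE _ fin(2,1) _ _ that] F ST(2) large
    by (simp add: cross_edges_commute Int_commute mult.commute)
  have split: "nbrs E w - W = (nbrs E w \<inter> S) \<union> (nbrs E w \<inter> T)" for w
    using nbrs_subset[OF G, of w] ST by auto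
  have card_split: "card (nbrs E w - W) = card (nbrs E w \<inter> S) + card (nbrs E w \<inter> T)" for w
    unfolding split using ST(2) fin by (intro card_Un_disjoint) auto
  have common: "card (nbrs E x \<inter> U \<inter> (nbrs E y \<inter> U)) + 1 \<le> r"
    if "triangle E x y z" "{x, y, z} = W" "U \<subseteq> V - W" for x y z U
  proof -
    have "card (nbrs E x \<inter> U \<inter> (nbrs E y \<inter> U)) \<le> card (nbrs E x \<inter> nbrs E y - W)"
      using that(3) finite_nbrs[OF G] by (intro card_mono) auto
    then show ?thesis using card_common_nbrs_outside_triangle[OF G r(1) that(1)] that(2) by simp
  qed
  \<comment> \<open>Otherwise the edges leaving \<open>W\<close> could not make up for a small part \<open>X\<close>; but a part with at most \<open>7 * r\<close> vertices is too small for the number of edges of \<open>F\<close>.\<close>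
  have big: "\<exists>w\<in>W. 2 * r \<le> card (nbrs E w \<inter> X)"
    if XY: "X \<union> Y = V - W" "finite X" "finite Y" "card X + card Y = m" "card X * card Y = card S * card T"
      and cXY: "\<And>w. card (nbrs E w - W) = card (nbrs E w \<inter> X) + card (nbrs E w \<inter> Y)" for X Y
  proof (rule ccontr)
    assume "\<not> (\<exists>w\<in>W. 2 * r \<le> card (nbrs E w \<inter> X))"
    then have small: "card (nbrs E a \<inter> X) < 2 * r" "card (nbrs E b \<inter> X) < 2 * r" "card (nbrs E c \<inter> X) < 2 * r"
      by (auto simp: W_def)
    let ?N = "\<lambda>w. nbrs E w \<inter> Y"
    have "card (?N a) + card (?N b) + card (?N c)
        \<le> card Y + card (?N a \<inter> ?N b) + card (?N b \<inter> ?N c) + card (?N c \<inter> ?N a)"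
      using XY by (intro card_Un_three_le) auto
    moreover have "card (?N a \<inter> ?N b) + 1 \<le> r"
      using common[of a b c Y] abc XY by (auto simp: W_def)
    moreover have "card (?N b \<inter> ?N c) + 1 \<le> r"
      using common[of b c a Y] triangle_rotate[OF abc] XY by (auto simp: W_def)
    moreover have "card (?N c \<inter> ?N a) + 1 \<le> r"
      using common[of c a b Y] triangle_rotate[OF triangle_rotate[OF abc]] XY by (auto simp: W_def)
    ultimately have "card (nbrs E a - W) + card (nbrs E b - W) + card (nbrs E c - W) + 6 \<le> card Y + 9 * r"
      unfolding cXY using small by linarith
    then have "card E + 3 \<le> card F + card Y + 9 * r"
      using edges_le_delete_triangle[OF G abc] by (simp add: F_def W_def)
    then have "card X \<le> 7 * r" using e' FST ST_le XY(4) r(2) by linarith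
    then have "card X * card Y \<le> 7 * r * m" using XY(4) by (intro mult_le_mono) auto
    then have "m\<^sup>2 + 3 \<le> 28 * r * m + 4 * r" using F_large FST XY(5) by linarith
    moreover have "(28 * r + 4) * m \<le> m\<^sup>2"
      unfolding power2_eq_square using n cV by (intro mult_le_mono1) linarith
    moreover have "r \<le> m" using n cV by linarith
    ultimately show False by (simp add: algebra_simps)
  qed
  obtain w1 where w1: "w1 \<in> W" "2 * r \<le> card (nbrs E w1 \<inter> S)"
    using big[OF ST(1) fin cST refl card_split] by blast
  obtain w2 where w2: "w2 \<in> W" "2 * r \<le> card (nbrs E w2 \<inter> T)"
    using big[of T S] ST(1) fin cST card_split by (auto simp: Un_commute add.commute mult.commute)
  have w1T: "nbrs E w1 \<inter> T = {}" using one_sided_T[OF w1(2)] .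
  have w2S: "nbrs E w2 \<inter> S = {}" using one_sided_S[OF w2(2)] .
  have "w1 \<noteq> w2" using w1(2) w2S r(2) by auto
  moreover have "card W = 3" using abc by (simp add: W_def triangle_def)
  ultimately have "card (W - {w1, w2}) = 1" using w1(1) w2(1) by (simp add: card_Diff_subset)
  then obtain w3 where "W - {w1, w2} = {w3}" by (auto simp: card_1_singleton_iff)
  then have w: "distinct [w1, w2, w3]" "{w1, w2, w3} = W"
    using w1(1) w2(1) \<open>w1 \<noteq> w2\<close> by auto
  have "\<forall>x\<in>W. \<forall>y\<in>W. x \<noteq> y \<longrightarrow> {x, y} \<in> E"
    using abc triangle_iff_pairwise[of a b c E] unfolding W_def by (simp add: triangle_def)
  then have tr: "triangle E w1 w2 w3" using triangle_iff_pairwise[OF w(1), of E] w(2) by simp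
  let ?S1 = "nbrs E w1 \<inter> S" and ?S3 = "nbrs E w3 \<inter> S"
    and ?T2 = "nbrs E w2 \<inter> T" and ?T3 = "nbrs E w3 \<inter> T"
  have "card ?S1 + card ?S3 = card (?S1 \<union> ?S3) + card (?S1 \<inter> ?S3)"
    using fin by (intro card_Un_Int) auto
  moreover have "card ?T2 + card ?T3 = card (?T2 \<union> ?T3) + card (?T2 \<inter> ?T3)"
    using fin by (intro card_Un_Int) auto
  moreover have "card E \<le> card F + 3 + (card ?S1 + card ?T2 + (card ?S3 + card ?T3))"
    using edges_le_delete_triangle[OF G tr] card_split w1T w2S by (simp add: w(2) F_def)
  moreover have S13: "card (?S1 \<union> ?S3) \<le> card S" "card (?T2 \<union> ?T3) \<le> card T"
    using fin by (auto intro!: card_mono)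
  moreover have "card (?S1 \<inter> ?S3) + 1 \<le> r"
  proof -
    have "{w3, w1, w2} = W" using w(2) by auto
    from common[OF triangle_rotate[OF triangle_rotate[OF tr]] this, of S] show ?thesis
      using ST(1) by (auto simp: Int_commute)
  qed
  moreover have "card (?T2 \<inter> ?T3) + 1 \<le> r"
  proof -
    have "{w2, w3, w1} = W" using w(2) by auto
    from common[OF triangle_rotate[OF tr] this, of T] show ?thesis using ST(1) by auto
  qed
  \<comment> \<open>The lower bound \<open>e'\<close> meets the upper bound, so every term of the estimate is extremal.\<close>
  ultimately have eq: "card F = card S * card T" "card S * card T = m\<^sup>2 div 4"
    "card (?S1 \<union> ?S3) = card S" "card (?T2 \<union> ?T3) = card T"
    "card (?S1 \<inter> ?S3) + 1 = r" "card (?T2 \<inter> ?T3) + 1 = r" "card E = m\<^sup>2 div 4 + m + 1 + 2 * r"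
    using FST ST_le e' cST by linarith+
  have F_eq: "F = cross_edges S T"
    using eq(1) by (intro card_subset_eq[OF finite_cross_edges[OF fin] F]) (simp add: card_cross_edges ST(2))
  have S_eq: "?S1 \<union> ?S3 = S" by (rule card_subset_eq[OF fin(1) _ eq(3)]) auto
  have T_eq: "?T2 \<union> ?T3 = T" by (rule card_subset_eq[OF fin(2) _ eq(4)]) auto
  have "nbrs E w1 - W = ?S1" "nbrs E w2 - W = ?T2" "nbrs E w3 - W = ?S3 \<union> ?T3"
    using split w1T w2S by auto
  then have "E = triangle_join S T w1 w2 w3 ?S1 ?T2 ?S3 ?T3"
    using edges_split_triangle[OF G tr] F_eq unfolding w(2) F_def triangle_join_def
    by (simp add: Un_ac)
  moreover have "V = S \<union> T \<union> {w1, w2, w3}"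
    using ST(1) w(2) tr edge_in_verts[OF G] unfolding triangle_def by blast
  moreover have "{w1, w2, w3} \<inter> (S \<union> T) = {}" using ST(1) w(2) by blast
  ultimately show ?thesis
    using that[OF _ ST(2) w(1) _ _ S_eq T_eq eq(5,6)] eq(2,7) cV square_div4_add2[of m] by simp
qed

section \<open>Graphs composed of a triangle and a complete bipartite graph\<close>

lemma triangle_join_swap:
  "triangle_join S T w1 w2 w3 S1 T2 S3 T3 = triangle_join T S w2 w1 w3 T2 S1 T3 S3"
  unfolding triangle_join_def
  by (simp add: cross_edges_commute[of T S] insert_commute Un_ac)

text \<open>The left-hand side counts common neighbours of the edge \<open>w3 s\<close>: all of \<open>T3\<close>, and \<open>w1\<close> if \<open>s\<close> is
adjacent to it. For \<open>r = 1\<close> this gives the product condition of the family, and for larger \<open>r\<close> it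
forces the neighbours of \<open>w3\<close> to be as few as possible.\<close>
lemma third_vertex_nbrs_le:
  assumes fin: "finite T" and E: "E = triangle_join S T w1 w2 w3 S1 T2 S3 T3" and r: "codegree_le r E"
    and G: "simple_graph (V, E)" and T3: "T3 \<subseteq> T" and w1: "w1 \<notin> T" and s: "s \<in> S3" "s \<in> S"
  shows "card T3 + (if s \<in> S1 then 1 else 0) \<le> r"
proof -
  let ?X = "T3 \<union> (if s \<in> S1 then {w1} else {})"
  have w3s: "{w3, s} \<in> E" unfolding E triangle_join_def using s by (simp add: cross_edges_iff)
  have "{w3, t} \<in> E \<and> {s, t} \<in> E" if "t \<in> T3" for t
    unfolding E triangle_join_def using s(2) that subsetD[OF T3 that] by (simp add: cross_edges_iff)
  moreover have "{w3, w1} \<in> E \<and> {s, w1} \<in> E" if "s \<in> S1"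
    unfolding E triangle_join_def using that by (simp add: cross_edges_iff)
  ultimately have "?X \<subseteq> nbrs E w3 \<inter> nbrs E s"
    by (auto simp: nbrs_def)
  then have "card ?X \<le> card (nbrs E w3 \<inter> nbrs E s)"
    using finite_nbrs[OF G] by (intro card_mono) auto
  moreover have "card (nbrs E w3 \<inter> nbrs E s) \<le> r" using r w3s by (auto simp: codegree_le_def)
  moreover have "card ?X = card T3 + (if s \<in> S1 then 1 else 0)"
    using w1 T3 finite_subset[OF T3 fin] by (auto simp: card_insert_if)
  ultimately show ?thesis by simp
qed

lemma codegree_leI:
  assumes "\<And>e. e \<in> E \<Longrightarrow> \<exists>u v. e = {u, v} \<and> card (nbrs E u \<inter> nbrs E v) \<le> r"
  shows "codegree_le r E"
  unfolding codegree_le_def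
proof (intro allI impI)
  fix u v assume "{u, v} \<in> E"
  from assms[OF this] obtain x y where "{u, v} = {x, y}" "card (nbrs E x \<inter> nbrs E y) \<le> r" by blast
  then show "card (nbrs E u \<inter> nbrs E v) \<le> r" by (auto simp: doubleton_eq_iff Int_commute)
qed

lemma triangle_not_bipartite:
  assumes "triangle E a b c"
  shows "\<not> bipartite (V, E)"
proof
  assume "bipartite (V, E)"
  then obtain A B where "A \<inter> B = {}" "E \<subseteq> cross_edges A B"
    by (rule bipartite_subset_cross_edges)
  then have "{a, b} \<in> cross_edges A B" "{b, c} \<in> cross_edges A B" "{c, a} \<in> cross_edges A B"
    using assms by (auto simp: triangle_def)
  then show False using \<open>A \<inter> B = {}\<close> by (auto simp: cross_edges_iff)
qed

locale triangle_join_graph =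
  fixes S T :: "'a set" and w1 w2 w3 :: 'a and S1 T2 S3 T3 :: "'a set"
  assumes fin: "finite S" "finite T" and disj: "S \<inter> T = {}"
    and w: "distinct [w1, w2, w3]" "{w1, w2, w3} \<inter> (S \<union> T) = {}"
    and sub: "S1 \<subseteq> S" "S3 \<subseteq> S" "T2 \<subseteq> T" "T3 \<subseteq> T"
begin

abbreviation "E \<equiv> triangle_join S T w1 w2 w3 S1 T2 S3 T3"

lemma edge_cases:
  assumes "e \<in> E"
  obtains s t where "s \<in> S" "t \<in> T" "e = {s, t}" | "e = {w1, w2}" | "e = {w2, w3}" | "e = {w3, w1}"
    | s where "s \<in> S3" "e = {w3, s}" | t where "t \<in> T3" "e = {w3, t}"
    | s where "s \<in> S1" "e = {w1, s}" | t where "t \<in> T2" "e = {w2, t}"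
  using assms unfolding triangle_join_def cross_edges_def by blast

lemma simple: "simple_graph (S \<union> T \<union> {w1, w2, w3}, E)"
  unfolding simple_graph_def fst_conv snd_conv
proof (intro conjI ballI)
  show "finite (S \<union> T \<union> {w1, w2, w3})" using fin by simp
  fix e assume "e \<in> E"
  then have "\<exists>x y. e = {x, y} \<and> x \<noteq> y \<and> x \<in> S \<union> T \<union> {w1, w2, w3} \<and> y \<in> S \<union> T \<union> {w1, w2, w3}"
  proof (cases rule: edge_cases)
    case (1 s t)
    then show ?thesis using disj by blast
  next
    case 2
    then show ?thesis using w(1) by (intro exI[of _ w1] exI[of _ w2]) simp
  next
    case 3
    then show ?thesis using w(1) by (intro exI[of _ w2] exI[of _ w3]) simp
  next
    case 4
    then show ?thesis using w(1) by (intro exI[of _ w3] exI[of _ w1]) auto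
  next
    case (5 s)
    then show ?thesis using w(2) sub by (intro exI[of _ w3] exI[of _ s]) auto
  next
    case (6 t)
    then show ?thesis using w(2) sub by (intro exI[of _ w3] exI[of _ t]) auto
  next
    case (7 s)
    then show ?thesis using w(2) sub by (intro exI[of _ w1] exI[of _ s]) auto
  next
    case (8 t)
    then show ?thesis using w(2) sub by (intro exI[of _ w2] exI[of _ t]) auto
  qed
  then obtain x y where "e = {x, y}" "x \<noteq> y" "x \<in> S \<union> T \<union> {w1, w2, w3}" "y \<in> S \<union> T \<union> {w1, w2, w3}" by blast
  then show "e \<subseteq> S \<union> T \<union> {w1, w2, w3}" "card e = 2" by simp_all
qed

lemma not_bip: "\<not> bipartite (V, E)"
  using w by (intro triangle_not_bipartite[of _ w1 w2 w3]) (simp add: triangle_def triangle_join_def)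

lemma card_edges: "card E = card S * card T + 3 + (card S1 + card T2 + (card S3 + card T3))"
proof -
  let ?A = "cross_edges S T" and ?B = "{{w1, w2}, {w2, w3}, {w3, w1}}" and ?C = "cross_edges {w3} (S3 \<union> T3)"
    and ?D = "cross_edges {w1} S1" and ?F = "cross_edges {w2} T2"
  have fins: "finite S1" "finite S3" "finite T2" "finite T3" using sub fin finite_subset by blast+
  have "?A \<inter> ?B = {}" "(?A \<union> ?B) \<inter> ?C = {}" "(?A \<union> ?B \<union> ?C) \<inter> ?D = {}" "(?A \<union> ?B \<union> ?C \<union> ?D) \<inter> ?F = {}"
    using w sub by (auto simp: cross_edges_def doubleton_eq_iff)
  then have "card E = card ?A + card ?B + card ?C + card ?D + card ?F"
    unfolding triangle_join_def using fin fins
    by (simp only: card_Un_disjoint finite_Un finite_cross_edges finite.intros simp_thms)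
  moreover have "card ?A = card S * card T" by (rule card_cross_edges[OF disj])
  moreover have "card ?B = 3" using w(1) by (auto simp: card_insert_if doubleton_eq_iff)
  moreover have "card ?C = card S3 + card T3"
    using w(2) sub disj fins by (subst card_cross_edges) (auto intro!: card_Un_disjoint)
  moreover have "card ?D = card S1" using w(2) sub by (subst card_cross_edges) auto
  moreover have "card ?F = card T2" using w(2) sub by (subst card_cross_edges) auto
  ultimately show ?thesis by simp
qed

lemma nbrs_S: "s \<in> S \<Longrightarrow> nbrs E s = T \<union> (if s \<in> S1 then {w1} else {}) \<union> (if s \<in> S3 then {w3} else {})"
  using w disj sub by (auto simp: nbrs_def triangle_join_def cross_edges_iff doubleton_eq_iff)

lemma nbrs_T: "t \<in> T \<Longrightarrow> nbrs E t = S \<union> (if t \<in> T2 then {w2} else {}) \<union> (if t \<in> T3 then {w3} else {})"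
  using w disj sub by (auto simp: nbrs_def triangle_join_def cross_edges_iff doubleton_eq_iff)

lemma nbrs_w: "nbrs E w1 = {w2, w3} \<union> S1" "nbrs E w2 = {w1, w3} \<union> T2" "nbrs E w3 = {w1, w2} \<union> S3 \<union> T3"
  using w sub by (auto simp: nbrs_def triangle_join_def cross_edges_iff doubleton_eq_iff)

text \<open>The edges \<open>w3 w1\<close> and \<open>w2 w3\<close> account for the first two hypotheses, and the edges from \<open>w3\<close> to the
two parts for the other two. Every other edge has at most one common neighbour.\<close>
lemma codegree:
  assumes S13: "card (S1 \<inter> S3) + 1 \<le> r" and T23: "card (T2 \<inter> T3) + 1 \<le> r"
    and S3: "\<And>s. s \<in> S3 \<Longrightarrow> card T3 + (if s \<in> S1 then 1 else 0) \<le> r"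
    and T3: "\<And>t. t \<in> T3 \<Longrightarrow> card S3 + (if t \<in> T2 then 1 else 0) \<le> r"
  shows "codegree_le r E"
proof (rule codegree_leI)
  have fins: "finite S1" "finite S3" "finite T2" "finite T3" using sub fin finite_subset by blast+
  have one: "card (nbrs E u \<inter> nbrs E v) \<le> r" if "nbrs E u \<inter> nbrs E v \<subseteq> {x}" for u v x
    using card_mono[OF _ that] S13 by simp
  have bound: "card (nbrs E u \<inter> nbrs E v) \<le> r"
    if "nbrs E u \<inter> nbrs E v \<subseteq> insert x X" "card X + 1 \<le> r" "finite X" for u v x X
    using card_mono[OF _ that(1)] card_insert_le_m1[of r X x] that(2,3) by (simp add: card_insert_if split: if_splits)
  fix e assume "e \<in> E"
  then show "\<exists>u v. e = {u, v} \<and> card (nbrs E u \<inter> nbrs E v) \<le> r"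
  proof (cases rule: edge_cases)
    case (1 s t)
    then have "nbrs E s \<inter> nbrs E t \<subseteq> {w3}" using w disj by (auto simp: nbrs_S nbrs_T split: if_splits)
    then show ?thesis using one 1 by blast
  next
    case 2
    have "nbrs E w1 \<inter> nbrs E w2 \<subseteq> {w3}" unfolding nbrs_w using w disj sub by auto
    then show ?thesis using one 2 by blast
  next
    case 3
    have "nbrs E w2 \<inter> nbrs E w3 \<subseteq> insert w1 (T2 \<inter> T3)" unfolding nbrs_w using w disj sub by auto
    then show ?thesis using bound[OF _ T23] fins 3 by blast
  next
    case 4
    have "nbrs E w3 \<inter> nbrs E w1 \<subseteq> insert w2 (S1 \<inter> S3)" unfolding nbrs_w using w disj sub by auto
    then show ?thesis using bound[OF _ S13] fins 4 by blast
  next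
    case (5 s)
    then have "s \<in> S" using sub by auto
    have "nbrs E w3 \<inter> nbrs E s \<subseteq> T3 \<union> (if s \<in> S1 then {w1} else {})"
      unfolding nbrs_w nbrs_S[OF \<open>s \<in> S\<close>] using w disj sub by auto
    then have "card (nbrs E w3 \<inter> nbrs E s) \<le> card (T3 \<union> (if s \<in> S1 then {w1} else {}))"
      using fins by (intro card_mono) auto
    also have "\<dots> \<le> card T3 + (if s \<in> S1 then 1 else 0)"
      using card_Un_le[of T3 "if s \<in> S1 then {w1} else {}"] by (simp split: if_splits)
    also have "\<dots> \<le> r" using S3 5 by blast
    finally show ?thesis using 5 by blast
  next
    case (6 t)
    then have "t \<in> T" using sub by auto
    have "nbrs E w3 \<inter> nbrs E t \<subseteq> S3 \<union> (if t \<in> T2 then {w2} else {})"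
      unfolding nbrs_w nbrs_T[OF \<open>t \<in> T\<close>] using w disj sub by auto
    then have "card (nbrs E w3 \<inter> nbrs E t) \<le> card (S3 \<union> (if t \<in> T2 then {w2} else {}))"
      using fins by (intro card_mono) auto
    also have "\<dots> \<le> card S3 + (if t \<in> T2 then 1 else 0)"
      using card_Un_le[of S3 "if t \<in> T2 then {w2} else {}"] by (simp split: if_splits)
    also have "\<dots> \<le> r" using T3 6 by blast
    finally show ?thesis using 6 by blast
  next
    case (7 s)
    then have "s \<in> S" using sub by auto
    have "nbrs E w1 \<inter> nbrs E s \<subseteq> {w3}"
      unfolding nbrs_w nbrs_S[OF \<open>s \<in> S\<close>] using w disj sub by auto
    then show ?thesis using one 7 by blast
  next
    case (8 t)
    then have "t \<in> T" using sub by auto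
    have "nbrs E w2 \<inter> nbrs E t \<subseteq> {w3}"
      unfolding nbrs_w nbrs_T[OF \<open>t \<in> T\<close>] using w disj sub by auto
    then show ?thesis using one 8 by blast
  qed
qed

end

section \<open>Isomorphism and balance\<close>

text \<open>If \<open>w1\<close> sees all of \<open>S\<close> and \<open>w2\<close> all of \<open>T\<close>, they can be moved into the parts \<open>T\<close> and \<open>S\<close>; what
remains is the single vertex \<open>w3\<close> joined to some vertices of both parts.\<close>
lemma triangle_join_full:
  "triangle_join S T w1 w2 w3 S T S3 T3 =
     cross_edges (insert w1 T) (insert w2 S) \<union> cross_edges {w3} (insert w1 T3 \<union> insert w2 S3)"
  unfolding triangle_join_def cross_edges_def by (auto simp: insert_commute)

lemma bij_betw_onto_subset:
  assumes "finite A" "finite B" "A' \<subseteq> A" "B' \<subseteq> B" "card A = card B" "card A' = card B'"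
  obtains f where "bij_betw f A B" "f ` A' = B'"
proof -
  have fin: "finite A'" "finite B'" using assms finite_subset by blast+
  have "card (A - A') = card (B - B')" using assms fin by (simp add: card_Diff_subset)
  then obtain g h where gh: "bij_betw g A' B'" "bij_betw h (A - A') (B - B')"
    using finite_same_card_bij assms fin by (metis finite_Diff)
  have "bij_betw (\<lambda>x. if x \<in> A' then g x else h x) (A' \<union> (A - A')) (B' \<union> (B - B'))"
    using gh by (intro bij_betw_disjoint_Un) auto
  moreover have "(\<lambda>x. if x \<in> A' then g x else h x) ` A' = B'"
    using gh(1) by (simp add: bij_betw_def)
  ultimately show ?thesis using that assms(3,4) by (simp add: Un_absorb1)
qed

lemma image_cross_edges: "(\<lambda>e. f ` e) ` cross_edges A B = cross_edges (f ` A) (f ` B)"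
  unfolding cross_edges_image image_image by (force simp: image_iff)

text \<open>A bijection between corresponding parts can be chosen to respect the neighbours of the extra vertex,
and any such choice works because all pairs across the parts are adjacent.\<close>
lemma graph_iso_joined_vertex:
  assumes fin: "finite P" "finite Q" "finite X" "finite Y"
    and disj: "P \<inter> Q = {}" "X \<inter> Y = {}" "v \<notin> P \<union> Q" "x \<notin> X \<union> Y"
    and sub: "P' \<subseteq> P" "Q' \<subseteq> Q" "X' \<subseteq> X" "Y' \<subseteq> Y"
    and card: "card P = card X" "card Q = card Y" "card P' = card X'" "card Q' = card Y'"
  shows "graph_iso (insert v (P \<union> Q), cross_edges P Q \<union> cross_edges {v} (P' \<union> Q'))
    (insert x (X \<union> Y), cross_edges X Y \<union> cross_edges {x} (X' \<union> Y'))"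
proof -
  obtain f where f: "bij_betw f P X" "f ` P' = X'"
    using bij_betw_onto_subset[OF fin(1,3) sub(1,3) card(1,3)] .
  obtain g where g: "bij_betw g Q Y" "g ` Q' = Y'"
    using bij_betw_onto_subset[OF fin(2,4) sub(2,4) card(2,4)] .
  define h where "h z = (if z \<in> P then f z else if z \<in> Q then g z else x)" for z
  have hP: "h z = f z" if "z \<in> P" for z using that by (simp add: h_def)
  have hQ: "h z = g z" if "z \<in> Q" for z using that disj by (auto simp: h_def)
  have hv: "h v = x" using disj by (simp add: h_def)
  have imP: "h ` A = f ` A" if "A \<subseteq> P" for A using that hP by (intro image_cong) auto
  have imQ: "h ` A = g ` A" if "A \<subseteq> Q" for A using that hQ by (intro image_cong) auto
  have "bij_betw h P X" using f(1) bij_betw_cong[of P h f X] hP by simp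
  moreover have "bij_betw h Q Y" using g(1) bij_betw_cong[of Q h g Y] hQ by simp
  ultimately have "bij_betw h (P \<union> Q) (X \<union> Y)" using disj(2) by (rule bij_betw_combine)
  moreover have "bij_betw h {v} {x}" using hv by (simp add: bij_betw_def)
  ultimately have "bij_betw h (P \<union> Q \<union> {v}) (X \<union> Y \<union> {x})"
    by (rule bij_betw_combine) (use disj(4) in simp)
  then have "bij_betw h (insert v (P \<union> Q)) (insert x (X \<union> Y))" by simp
  moreover have "cross_edges X Y \<union> cross_edges {x} (X' \<union> Y')
      = (\<lambda>e. h ` e) ` (cross_edges P Q \<union> cross_edges {v} (P' \<union> Q'))"
    unfolding image_Un image_cross_edges imP[OF order_refl] imQ[OF order_refl] imP[OF sub(1)] imQ[OF sub(2)]
    using f g hv by (simp add: bij_betw_def)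
  ultimately show ?thesis unfolding graph_iso_def by auto
qed

lemma graph_iso_refl: "graph_iso G G"
  unfolding graph_iso_def by (intro exI[of _ id]) simp

lemma balanced_of_product:
  fixes a b :: nat
  assumes "a * b = (a + b)\<^sup>2 div 4" "a \<le> b"
  shows "a = (a + b) div 2" "b = (a + b + 1) div 2"
proof -
  obtain d where d: "b = a + d" using assms(2) by (metis le_iff_add)
  have "(a + b)\<^sup>2 = d\<^sup>2 + 4 * (a * b)" unfolding d by (simp add: power2_eq_square algebra_simps)
  then have "d\<^sup>2 div 4 = 0" using assms(1) by simp
  then have "d < 2" using power_mono[of 2 d 2] by (fastforce simp: not_less)
  then show "a = (a + b) div 2" "b = (a + b + 1) div 2" using d by auto
qed

text \<open>Being balanced is the same as having the largest possible number of edges. The counting arguments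
only provide the product of the part sizes.\<close>
lemma balanced_parts_iff:
  assumes "finite S" "finite T" "S \<inter> T = {}"
  shows "balanced_parts m S T \<longleftrightarrow> card S + card T = m \<and> card S * card T = m\<^sup>2 div 4"
proof
  assume b: "balanced_parts m S T"
  have "(m div 2) * ((m + 1) div 2) = m\<^sup>2 div 4"
  proof (cases "even m")
    case True
    then obtain k where "m = 2 * k" by blast
    then show ?thesis by (simp add: power2_eq_square)
  next
    case False
    then obtain k where k: "m = 2 * k + 1" by (blast elim: oddE)
    then have "m\<^sup>2 = 1 + 4 * (k * (k + 1))" by (simp add: power2_eq_square algebra_simps)
    then have "m\<^sup>2 div 4 = k * (k + 1)" by presburger
    then show ?thesis using k by simp
  qed
  then show "card S + card T = m \<and> card S * card T = m\<^sup>2 div 4"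
    using b by (auto simp: balanced_parts_def doubleton_eq_iff mult.commute)
next
  assume m: "card S + card T = m \<and> card S * card T = m\<^sup>2 div 4"
  have "{card S, card T} = {m div 2, (m + 1) div 2}"
  proof (cases "card S \<le> card T")
    case True
    then show ?thesis using balanced_of_product[of "card S" "card T"] m by simp
  next
    case False
    then have "card T = m div 2 \<and> card S = (m + 1) div 2"
      using balanced_of_product[of "card T" "card S"] m by (simp add: mult.commute add.commute)
    then show ?thesis by auto
  qed
  then show "balanced_parts m S T" using assms m by (simp add: balanced_parts_def)
qed

section \<open>Extremal number and extremal graphs\<close>

lemma nonbip_free_graphs_iff:
  "(V, E) \<in> nonbip_free_graphs n (book (r + 1)) \<longleftrightarrow>
     simple_graph (V, E) \<and> card V = n \<and> \<not> bipartite (V, E) \<and> codegree_le r E"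
  unfolding nonbip_free_graphs_def using free_of_book_iff[of V E r] by auto

lemma edges_le_extremal:
  assumes "r \<ge> 1" "n \<ge> 18 * r\<^sup>2 + 36 * r + 10" "G \<in> nonbip_free_graphs n (book (r + 1))"
  shows "card (edges G) \<le> (n - 1)\<^sup>2 div 4 + 2 * r"
proof (rule ccontr)
  obtain V E where G: "G = (V, E)" by (cases G)
  then have VE: "simple_graph (V, E)" "card V = n" "\<not> bipartite (V, E)" "codegree_le r E"
    using assms(3) nonbip_free_graphs_iff by blast+
  assume "\<not> card (edges G) \<le> (n - 1)\<^sup>2 div 4 + 2 * r"
  then have gt: "card E > (card V - 1)\<^sup>2 div 4 + 2 * r" using G VE(2) by simp
  then have "(card V - 1)\<^sup>2 div 4 + 2 * r \<le> card E" by simp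
  from extremal_structure[OF VE(1,4) assms(1) VE(3) assms(2)[folded VE(2)] this]
  have "card E = (card V - 1)\<^sup>2 div 4 + 2 * r" by metis
  then show False using gt by simp
qed

text \<open>Where \<open>S1\<close> and \<open>S3\<close> cover \<open>S\<close> with overlap \<open>r - 1\<close>, and likewise in \<open>T\<close>, the triangle sends
\<open>m + 2 * (r - 1)\<close> edges to the parts, which is what the upper bound permits.\<close>
lemma (in triangle_join_graph) extremal:
  fixes r :: nat
  assumes cover: "S1 \<union> S3 = S" "T2 \<union> T3 = T"
    and r: "card (S1 \<inter> S3) + 1 = r" "card (T2 \<inter> T3) + 1 = r"
    and S3: "\<And>s. s \<in> S3 \<Longrightarrow> card T3 + (if s \<in> S1 then 1 else 0) \<le> r"
    and T3: "\<And>t. t \<in> T3 \<Longrightarrow> card S3 + (if t \<in> T2 then 1 else 0) \<le> r"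
    and bal: "balanced_parts m S T"
  shows "simple_graph (S \<union> T \<union> {w1, w2, w3}, E)" "card (S \<union> T \<union> {w1, w2, w3}) = m + 3"
    "\<not> bipartite (V, E)" "codegree_le r E" "card E = (m + 2)\<^sup>2 div 4 + 2 * r"
proof -
  have ST: "card S + card T = m" "card S * card T = m\<^sup>2 div 4"
    using balanced_parts_iff[OF fin disj] bal by auto
  have fins: "finite S1" "finite S3" "finite T2" "finite T3" using sub fin finite_subset by blast+
  show "simple_graph (S \<union> T \<union> {w1, w2, w3}, E)" by (rule simple)
  show "\<not> bipartite (V, E)" by (rule not_bip)
  show "codegree_le r E" using r S3 T3 by (intro codegree) auto
  have "card (S \<union> T \<union> {w1, w2, w3}) = card (S \<union> T) + card {w1, w2, w3}"
    using fin w(2) by (intro card_Un_disjoint) auto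
  then show "card (S \<union> T \<union> {w1, w2, w3}) = m + 3"
    using w(1) ST(1) card_Un_disjoint[OF fin disj] by simp
  have "card S1 + card S3 + 1 = card S + r" "card T2 + card T3 + 1 = card T + r"
    using card_Un_Int[OF fins(1,2)] card_Un_Int[OF fins(3,4)] cover r by auto
  then show "card E = (m + 2)\<^sup>2 div 4 + 2 * r"
    unfolding card_edges square_div4_add2 using ST by linarith
qed

text \<open>The new vertex \<open>0\<close> forms a triangle with the vertices \<open>1\<close> and \<open>p + 1\<close>, its first neighbours in the
two parts.\<close>
lemma K_plus_eq_triangle_join:
  assumes "1 \<le> r" "r \<le> p" "p \<le> q"
  shows "K_plus p q r = ({p + 2..p + q} \<union> {2..p} \<union> {1, p + 1, 0},
    triangle_join {p + 2..p + q} {2..p} 1 (p + 1) 0 {p + 2..p + q} {2..p} {p + 2..p + r} {2..r})"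
proof -
  have ins: "insert 1 {2..k} = {1..k}" "insert (p + 1) {p + 2..p + k} = {p + 1..p + k}"
    if "1 \<le> k" for k using that by auto
  have "{0..p + q} = {p + 2..p + q} \<union> {2..p} \<union> {1, p + 1, 0}" using assms by auto
  then show ?thesis
    unfolding K_plus_def triangle_join_full using assms by (simp only: ins order.trans[of 1 r p] order.trans[of 1 p q])
qed

lemma K_plus_extremal:
  assumes r: "1 \<le> r" and n: "2 * r + 1 \<le> n" "3 \<le> n"
  shows "K_plus ((n - 1) div 2) (n div 2) r \<in> nonbip_free_graphs n (book (r + 1))"
    and "card (edges (K_plus ((n - 1) div 2) (n div 2) r)) = (n - 1)\<^sup>2 div 4 + 2 * r"
proof -
  define p where "p = (n - 1) div 2"
  define q where "q = n div 2"
  have pq: "r \<le> p" "p \<le> q" using r n by (auto simp: p_def q_def)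
  interpret triangle_join_graph "{p + 2..p + q}" "{2..p}" 1 "p + 1" 0 "{p + 2..p + q}" "{2..p}" "{p + 2..p + r}" "{2..r}"
    using r pq by unfold_locales auto
  have cover: "{p + 2..p + q} \<union> {p + 2..p + r} = {p + 2..p + q}" "{2..p} \<union> {2..r} = {2..p}"
    using pq by auto
  have inter: "{p + 2..p + q} \<inter> {p + 2..p + r} = {p + 2..p + r}" "{2..p} \<inter> {2..r} = {2..r}"
    using pq by auto
  have cards: "card ({p + 2..p + q} \<inter> {p + 2..p + r}) + 1 = r" "card ({2..p} \<inter> {2..r}) + 1 = r"
    unfolding inter using r by simp_all
  have S3: "card {2..r} + (if s \<in> {p + 2..p + q} then 1 else 0) \<le> r" for s
    using r by simp
  have T3: "card {p + 2..p + r} + (if t \<in> {2..p} then 1 else 0) \<le> r" for t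
    using r by simp
  have bal: "balanced_parts (n - 3) {p + 2..p + q} {2..p}"
  proof -
    have "p - 1 = (n - 3) div 2" "q - 1 = (n - 3 + 1) div 2" "q - 1 + (p - 1) = n - 3"
      using n r unfolding p_def q_def by linarith+
    moreover have "card {p + 2..p + q} = q - 1" "card {2..p} = p - 1" by simp_all
    ultimately show ?thesis unfolding balanced_parts_def by auto
  qed
  note ex = extremal[OF cover cards S3 T3 bal]
  have n3: "n - 3 + 3 = n" "n - 3 + 2 = n - 1" using n by auto
  show "K_plus ((n - 1) div 2) (n div 2) r \<in> nonbip_free_graphs n (book (r + 1))"
    unfolding p_def[symmetric] q_def[symmetric] K_plus_eq_triangle_join[OF r pq] nonbip_free_graphs_iff
    by (intro conjI ex(1,3,4) ex(2)[unfolded n3])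
  show "card (edges (K_plus ((n - 1) div 2) (n div 2) r)) = (n - 1)\<^sup>2 div 4 + 2 * r"
    unfolding p_def[symmetric] q_def[symmetric] K_plus_eq_triangle_join[OF r pq] snd_conv
    by (rule ex(5)[unfolded n3])
qed

lemma ex3_book:
  assumes r: "r \<ge> 1" and n: "n \<ge> 18 * r\<^sup>2 + 36 * r + 10"
  shows "ex3 n (book (r + 1)) = (n - 1)\<^sup>2 div 4 + 2 * r"
  unfolding ex3_def
proof (rule Max_eqI)
  have n': "2 * r + 1 \<le> n" "3 \<le> n" using n by linarith+
  let ?c = "\<lambda>G :: nat ugraph. card (edges G)"
  have le: "x \<le> (n - 1)\<^sup>2 div 4 + 2 * r" if "x \<in> ?c ` nonbip_free_graphs n (book (r + 1))" for x
    using that edges_le_extremal[OF r n] by auto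
  then show "\<And>x. x \<in> ?c ` nonbip_free_graphs n (book (r + 1)) \<Longrightarrow> x \<le> (n - 1)\<^sup>2 div 4 + 2 * r" .
  show "finite (?c ` nonbip_free_graphs n (book (r + 1)))"
    by (rule finite_subset[of _ "{..(n - 1)\<^sup>2 div 4 + 2 * r}"]) (use le in auto)
  show "(n - 1)\<^sup>2 div 4 + 2 * r \<in> ?c ` nonbip_free_graphs n (book (r + 1))"
    using K_plus_extremal[OF r n'] by (metis imageI)
qed

lemma Ex3_book_iff:
  assumes "r \<ge> 1" "n \<ge> 18 * r\<^sup>2 + 36 * r + 10"
  shows "(V, E) \<in> Ex3 n (book (r + 1)) \<longleftrightarrow>
     simple_graph (V, E) \<and> card V = n \<and> \<not> bipartite (V, E) \<and> codegree_le r E \<and>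
     card E = (n - 1)\<^sup>2 div 4 + 2 * r"
  unfolding Ex3_def using ex3_book[OF assms] nonbip_free_graphs_iff[of V E n r] by auto

text \<open>The structure of all extremal graphs, for every \<open>r\<close>; the cases \<open>r = 1\<close> and \<open>r \<ge> 2\<close> differ only in
what the last two conditions mean.\<close>
lemma Ex3_book_structure:
  assumes r: "r \<ge> 1" and n: "n \<ge> 18 * r\<^sup>2 + 36 * r + 10" and VE: "(V, E) \<in> Ex3 n (book (r + 1))"
  obtains S T w1 w2 w3 S1 T2 S3 T3 where
    "V = S \<union> T \<union> {w1, w2, w3}" "distinct [w1, w2, w3]" "{w1, w2, w3} \<inter> (S \<union> T) = {}"
    "balanced_parts (n - 3) S T" "E = triangle_join S T w1 w2 w3 S1 T2 S3 T3"
    "S1 \<union> S3 = S" "T2 \<union> T3 = T" "card (S1 \<inter> S3) + 1 = r" "card (T2 \<inter> T3) + 1 = r"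
    "\<And>s. s \<in> S3 \<Longrightarrow> card T3 + (if s \<in> S1 then 1 else 0) \<le> r"
    "\<And>t. t \<in> T3 \<Longrightarrow> card S3 + (if t \<in> T2 then 1 else 0) \<le> r"
proof -
  have G: "simple_graph (V, E)" "card V = n" "\<not> bipartite (V, E)" "codegree_le r E"
    "card E = (card V - 1)\<^sup>2 div 4 + 2 * r"
    using Ex3_book_iff[OF r n] VE by auto
  obtain S T w1 w2 w3 S1 T2 S3 T3 where
    V: "V = S \<union> T \<union> {w1, w2, w3}" and disj: "S \<inter> T = {}" and w: "distinct [w1, w2, w3]" "{w1, w2, w3} \<inter> (S \<union> T) = {}"
    and E: "E = triangle_join S T w1 w2 w3 S1 T2 S3 T3"
    and cover: "S1 \<union> S3 = S" "T2 \<union> T3 = T" and cards: "card (S1 \<inter> S3) + 1 = r" "card (T2 \<inter> T3) + 1 = r"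
    and ST: "card S * card T = (card V - 3)\<^sup>2 div 4"
    by (rule extremal_structure[OF G(1,4) r G(3) n[folded G(2)] eq_refl[OF G(5)[symmetric]]])
  have fin: "finite S" "finite T" using V G(1) by (auto simp: simple_graph_def)
  have "card V = card (S \<union> T) + card {w1, w2, w3}"
    unfolding V using fin w(2) by (intro card_Un_disjoint) auto
  then have "card S + card T = n - 3" using G(2) w(1) card_Un_disjoint[OF fin disj] by simp
  then have bal: "balanced_parts (n - 3) S T" using balanced_parts_iff[OF fin disj] ST G(2) by simp
  have "card T3 + (if s \<in> S1 then 1 else 0) \<le> r" if "s \<in> S3" for s
    by (rule third_vertex_nbrs_le[OF fin(2) E G(4,1)]) (use cover w(2) that in auto)
  moreover have "card S3 + (if t \<in> T2 then 1 else 0) \<le> r" if "t \<in> T3" for t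
    by (rule third_vertex_nbrs_le[OF fin(1) E[unfolded triangle_join_swap[of S T]] G(4,1)]) (use cover w(2) that in auto)
  ultimately show ?thesis by (rule that[OF V w bal E cover cards])
qed

lemma G1_B2_iff:
  "G \<in> G1_B2 n \<longleftrightarrow> (\<exists>S T S1 T1 w1 w2 w3.
     G = (S \<union> T \<union> {w1, w2, w3}, triangle_join S T w1 w2 w3 (S - S1) (T - T1) S1 T1) \<and>
     balanced_parts (n - 3) S T \<and> S1 \<subseteq> S \<and> T1 \<subseteq> T \<and> card S1 * card T1 \<le> 1 \<and>
     distinct [w1, w2, w3] \<and> {w1, w2, w3} \<inter> (S \<union> T) = {})"
  unfolding G1_B2_def triangle_join_def mem_Collect_eq by (rule refl)

text \<open>For \<open>r = 1\<close> the overlaps are empty, so \<open>w3\<close> takes its neighbours away from \<open>w1\<close> and \<open>w2\<close>. Since the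
family is closed under renaming of vertices, the two sets of graphs are equal, not merely equal up
to isomorphism.\<close>
lemma Ex3_book_2:
  assumes n: "n \<ge> 64"
  shows "Ex3 n (book (1 + 1)) = G1_B2 n"
proof (intro equalityI subsetI)
  have n': "n \<ge> 18 * 1\<^sup>2 + 36 * 1 + 10" using n by simp
  fix G assume G: "G \<in> Ex3 n (book (1 + 1))"
  obtain V E where VE: "G = (V, E)" by (cases G)
  obtain S T w1 w2 w3 S1 T2 S3 T3 where
    V: "V = S \<union> T \<union> {w1, w2, w3}" and w: "distinct [w1, w2, w3]" "{w1, w2, w3} \<inter> (S \<union> T) = {}"
    and bal: "balanced_parts (n - 3) S T" and E: "E = triangle_join S T w1 w2 w3 S1 T2 S3 T3"
    and cover: "S1 \<union> S3 = S" "T2 \<union> T3 = T" and cards: "card (S1 \<inter> S3) + 1 = (1 :: nat)" "card (T2 \<inter> T3) + 1 = (1 :: nat)"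
    and S3: "\<And>s. s \<in> S3 \<Longrightarrow> card T3 + (if s \<in> S1 then 1 else 0) \<le> (1 :: nat)"
    and T3: "\<And>t. t \<in> T3 \<Longrightarrow> card S3 + (if t \<in> T2 then 1 else 0) \<le> (1 :: nat)"
    using Ex3_book_structure[OF order_refl n' G[unfolded VE]] by metis
  have "finite S" "finite T" using bal by (auto simp: balanced_parts_def)
  then have "finite S1" "finite T2" using cover by auto
  then have "S1 \<inter> S3 = {}" "T2 \<inter> T3 = {}" using cards by auto
  then have diff: "S1 = S - S3" "T2 = T - T3" using cover by auto
  have sub: "S3 \<subseteq> S" "T3 \<subseteq> T" using cover by auto
  have prod: "card S3 * card T3 \<le> 1"
  proof (cases "S3 = {} \<or> T3 = {}")
    case False
    then have "card S3 \<le> 1" "card T3 \<le> 1" using S3 T3 by fastforce+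
    then show ?thesis using mult_le_mono[of "card S3" 1 "card T3" 1] by simp
  qed auto
  show "G \<in> G1_B2 n"
    unfolding G1_B2_iff
    by (rule exI[of _ S], rule exI[of _ T], rule exI[of _ S3], rule exI[of _ T3],
        rule exI[of _ w1], rule exI[of _ w2], rule exI[of _ w3])
      (intro conjI bal sub prod w, simp only: VE V E diff)
next
  have n': "n \<ge> 18 * 1\<^sup>2 + 36 * 1 + 10" using n by simp
  fix G assume "G \<in> G1_B2 n"
  then obtain S T S1 T1 w1 w2 w3 where
    G: "G = (S \<union> T \<union> {w1, w2, w3}, triangle_join S T w1 w2 w3 (S - S1) (T - T1) S1 T1)"
    and bal: "balanced_parts (n - 3) S T" and sub: "S1 \<subseteq> S" "T1 \<subseteq> T" and prod: "card S1 * card T1 \<le> 1"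
    and w: "distinct [w1, w2, w3]" "{w1, w2, w3} \<inter> (S \<union> T) = {}"
    unfolding G1_B2_iff by (elim exE conjE)
  interpret triangle_join_graph S T w1 w2 w3 "S - S1" "T - T1" S1 T1
    using bal sub w by unfold_locales (auto simp: balanced_parts_def)
  have "finite S1" "finite T1" using sub fin finite_subset by blast+
  then have "card T1 \<le> 1" if "s \<in> S1" for s
    using prod that card_gt_0_iff[of S1] mult_le_mono1[of 1 "card S1" "card T1"] by fastforce
  moreover have "card S1 \<le> 1" if "t \<in> T1" for t
    using prod that \<open>finite T1\<close> card_gt_0_iff[of T1] mult_le_mono2[of 1 "card T1" "card S1"] by fastforce
  ultimately have S3: "\<And>s. s \<in> S1 \<Longrightarrow> card T1 + (if s \<in> S - S1 then 1 else 0) \<le> (1 :: nat)"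
    and T3: "\<And>t. t \<in> T1 \<Longrightarrow> card S1 + (if t \<in> T - T1 then 1 else 0) \<le> (1 :: nat)"
    by auto
  have cover: "S - S1 \<union> S1 = S" "T - T1 \<union> T1 = T" using sub by auto
  have cards: "card ((S - S1) \<inter> S1) + 1 = (1 :: nat)" "card ((T - T1) \<inter> T1) + 1 = (1 :: nat)"
    by (simp_all add: Int_commute)
  note ex = extremal[OF cover cards S3 T3 bal]
  have n3: "n - 3 + 3 = n" "n - 3 + 2 = n - 1" using n by auto
  show "G \<in> Ex3 n (book (1 + 1))"
    unfolding G Ex3_book_iff[OF order_refl n']
    by (intro conjI ex(1,3,4) ex(2,5)[unfolded n3])
qed

text \<open>For \<open>r \<ge> 2\<close> the overlap \<open>S1 \<inter> S3\<close> is nonempty. A vertex \<open>s\<close> in it has all of \<open>T3\<close> and \<open>w1\<close> as common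
neighbours with \<open>w3\<close>, so \<open>T3\<close> has at most \<open>r - 1\<close> elements and hence is contained in \<open>T2\<close>; by
symmetry \<open>S3\<close> is contained in \<open>S1\<close>. Thus \<open>S1 = S\<close> and \<open>T2 = T\<close>, and the graph is a complete bipartite
graph with one extra vertex.\<close>
lemma Ex3_book_iso_K_plus:
  assumes r: "r \<ge> 2" and n: "n \<ge> 18 * r\<^sup>2 + 36 * r + 10" and VE: "(V, E) \<in> Ex3 n (book (r + 1))"
  shows "graph_iso (V, E) (K_plus ((n - 1) div 2) (n div 2) r)"
proof -
  define p where "p = (n - 1) div 2"
  define q where "q = n div 2"
  have pq: "r \<le> p" "r \<le> q" using r n unfolding p_def q_def by linarith+
  have r1: "r \<ge> 1" using r by simp
  obtain S T w1 w2 w3 S1 T2 S3 T3 where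
    V: "V = S \<union> T \<union> {w1, w2, w3}" and w: "distinct [w1, w2, w3]" "{w1, w2, w3} \<inter> (S \<union> T) = {}"
    and bal: "balanced_parts (n - 3) S T" and E: "E = triangle_join S T w1 w2 w3 S1 T2 S3 T3"
    and cover: "S1 \<union> S3 = S" "T2 \<union> T3 = T" and cards: "card (S1 \<inter> S3) + 1 = r" "card (T2 \<inter> T3) + 1 = r"
    and S3: "\<And>s. s \<in> S3 \<Longrightarrow> card T3 + (if s \<in> S1 then 1 else 0) \<le> r"
    and T3: "\<And>t. t \<in> T3 \<Longrightarrow> card S3 + (if t \<in> T2 then 1 else 0) \<le> r"
    using Ex3_book_structure[OF r1 n VE] by metis
  have fin: "finite S" "finite T" and disj: "S \<inter> T = {}" using bal by (auto simp: balanced_parts_def)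
  have fins: "finite S3" "finite T3" using cover fin by auto
  have "S1 \<inter> S3 \<noteq> {}" "T2 \<inter> T3 \<noteq> {}" using cards r by auto
  then have "card T3 + 1 \<le> r" "card S3 + 1 \<le> r" using S3 T3 by fastforce+
  then have "T2 \<inter> T3 = T3" "S1 \<inter> S3 = S3"
    using cards by (intro card_seteq fins; simp)+
  then have full: "S1 = S" "T2 = T" and c3: "card S3 + 1 = r" "card T3 + 1 = r"
    using cover cards by auto
  have sub: "S3 \<subseteq> S" "T3 \<subseteq> T" using cover by auto
  let ?P = "insert w1 T" and ?Q = "insert w2 S" and ?P' = "insert w1 T3" and ?Q' = "insert w2 S3"
  have VP: "V = insert w3 (?P \<union> ?Q)" unfolding V by auto
  have E': "E = cross_edges ?P ?Q \<union> cross_edges {w3} (?P' \<union> ?Q')"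
    unfolding E full triangle_join_full by simp
  have K: "K_plus p q r = (insert 0 ({1..p} \<union> {p + 1..p + q}),
      cross_edges {1..p} {p + 1..p + q} \<union> cross_edges {0} ({1..r} \<union> {p + 1..p + r}))"
    unfolding K_plus_def by (auto intro!: arg_cong2[where f = Pair])
  have cPQ: "card ?P = card T + 1" "card ?Q = card S + 1" "card ?P' = r" "card ?Q' = r"
    using w(2) fin fins sub c3 by (auto simp: card_insert_if)
  have dPQ: "?P \<inter> ?Q = {}" "?Q \<inter> ?P = {}" "w3 \<notin> ?P \<union> ?Q" "w3 \<notin> ?Q \<union> ?P" using w disj by auto
  have subs: "?P' \<subseteq> ?P" "?Q' \<subseteq> ?Q" using sub by auto
  have X: "{1..p} \<inter> {p + 1..p + q} = {}" "0 \<notin> {1..p} \<union> {p + 1..p + q}"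
    "{1..r} \<subseteq> {1..p}" "{p + 1..p + r} \<subseteq> {p + 1..p + q}" using pq by auto
  have "(n - 3) div 2 + 1 = p" "(n - 3 + 1) div 2 + 1 = q" using n unfolding p_def q_def by linarith+
  \<comment> \<open>Either of the two parts may be the smaller one.\<close>
  then consider "card T + 1 = p" "card S + 1 = q" | "card S + 1 = p" "card T + 1 = q"
    using bal unfolding balanced_parts_def doubleton_eq_iff by auto
  then have "graph_iso (V, E) (K_plus p q r)"
  proof cases
    case 1
    then show ?thesis unfolding VP E' K
      by (intro graph_iso_joined_vertex) (use fin dPQ subs X cPQ in auto)
  next
    case 2
    have "V = insert w3 (?Q \<union> ?P)" "E = cross_edges ?Q ?P \<union> cross_edges {w3} (?Q' \<union> ?P')"
      unfolding VP E' by (auto simp: cross_edges_commute[of ?P ?Q] Un_commute)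
    then show ?thesis unfolding K
      by (simp only:) (intro graph_iso_joined_vertex; use fin dPQ subs X cPQ 2 in auto)
  qed
  then show ?thesis unfolding p_def q_def .
qed

theorem theorem1p9:
  fixes r :: nat
  assumes "r \<ge> 1"
  shows "\<exists>n0. \<forall>n\<ge>n0.
    ex3 n (book (r + 1)) = (n - 1)^2 div 4 + 2 * r \<and>
    (r = 1 \<longrightarrow> same_up_to_iso (Ex3 n (book (r + 1))) (G1_B2 n)) \<and>
    (r \<ge> 2 \<longrightarrow> same_up_to_iso (Ex3 n (book (r + 1))) {K_plus ((n - 1) div 2) (n div 2) r})"
proof (intro exI allI impI conjI)
  fix n assume n: "n \<ge> 18 * r\<^sup>2 + 36 * r + 10"
  show "ex3 n (book (r + 1)) = (n - 1)^2 div 4 + 2 * r" by (rule ex3_book[OF assms n])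
  show "same_up_to_iso (Ex3 n (book (r + 1))) (G1_B2 n)" if "r = 1"
    using Ex3_book_2[of n] n that graph_iso_refl unfolding same_up_to_iso_def by auto
  let ?K = "K_plus ((n - 1) div 2) (n div 2) r"
  show "same_up_to_iso (Ex3 n (book (r + 1))) {?K}" if "r \<ge> 2"
  proof -
    have "2 * r + 1 \<le> n" "3 \<le> n" using n by linarith+
    from K_plus_extremal[OF assms this] have "?K \<in> Ex3 n (book (r + 1))"
      unfolding Ex3_def ex3_book[OF assms n] by simp
    moreover have "graph_iso G ?K" if "G \<in> Ex3 n (book (r + 1))" for G
      using Ex3_book_iso_K_plus[OF \<open>r \<ge> 2\<close> n] that by (cases G) simp
    ultimately show ?thesis unfolding same_up_to_iso_def by blast
  qed
qed

end
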